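(* Let $n$ be a positive odd integer, and for $k\geqslant 0$ let $$c_q(k)=[3k+1]\frac{(aq,q/a,q;q^2)_k\, q^{-\binom{k+1}{2}}}{(aq,q/a;q)_k(q^2;q^2)_k}.$$ Then $$\sum_{k=0}^{n-1}\sum_{j=0}^{k}c_q(j)c_q(k-j)\equiv q^{1-n}[n]^2\pmod{[n](1-aq^n)(a-q^n)}.$$
   Context: Here $q$ and $a$ are indeterminates. The $q$-shifted factorial is $(x;q)_0=1$ and $(x;q)_m=(1-x)(1-xq)\cdots(1-xq^{m-1})$ for $m\geqslant1$, with $(x_1,\ldots,x_r;q)_m=(x_1;q)_m\cdots(x_r;q)_m$; the $q$-integer is $[m]=1+q+\cdots+q^{m-1}$. For rational functions $A,B$ in $q,a$ and a polynomial $P$ in $q,a$, $A\equiv B\pmod{P}$ means that $A-B=P\cdot U/V$ for polynomials $U,V$ with $V$ coprime to $P$. *)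

theory Defs
  imports "HOL-Computational_Algebra.Computational_Algebra"
begin

text \<open>Polynomials in \<open>q\<close> and \<open>a\<close> over the rationals are encoded as \<open>\<rat>[q][a]\<close>: the inner
  polynomial variable is \<open>q\<close>, the outer one is \<open>a\<close>. Rational functions form its field of fractions.\<close>

type_synonym qa_poly = "rat poly poly"
type_synonym qa_ratfun = "rat poly poly fract"

definition q_poly :: qa_poly where "q_poly = [:[:0, 1:]:]"
definition a_poly :: qa_poly where "a_poly = [:0, 1:]"

definition q_rat :: qa_ratfun where "q_rat = to_fract q_poly"
definition a_rat :: qa_ratfun where "a_rat = to_fract a_poly"

definition qpoch :: "'a::comm_ring_1 \<Rightarrow> 'a \<Rightarrow> nat \<Rightarrow> 'a" where
  "qpoch x q m = (\<Prod>i<m. 1 - x * q ^ i)"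

definition qpochs :: "'a::comm_ring_1 list \<Rightarrow> 'a \<Rightarrow> nat \<Rightarrow> 'a" where
  "qpochs xs q m = (\<Prod>x\<leftarrow>xs. qpoch x q m)"

definition qint :: "'a::comm_ring_1 \<Rightarrow> nat \<Rightarrow> 'a" where
  "qint q m = (\<Sum>i<m. q ^ i)"

definition ratfun_cong :: "qa_ratfun \<Rightarrow> qa_ratfun \<Rightarrow> qa_poly \<Rightarrow> bool" where
  "ratfun_cong A B P \<longleftrightarrow>
     (\<exists>U V. V \<noteq> 0 \<and> coprime V P \<and> A - B = to_fract P * (to_fract U / to_fract V))"

definition c_q :: "nat \<Rightarrow> qa_ratfun" where
  "c_q k = (let q = q_rat; a = a_rat in
     qint q (3 * k + 1)
       * (qpochs [a * q, q / a, q] (q\<^sup>2) k * q powi (- int ((k + 1) choose 2)))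
       / (qpochs [a * q, q / a] q k * qpoch (q\<^sup>2) (q\<^sup>2) k))"

end

theory Submission
  imports Defs "Subresultants.More_Homomorphisms" "HOL-Computational_Algebra.Field_as_Ring"
begin

text \<open>Write the difference of the two sides as \<open>N / V\<close> with polynomials \<open>N\<close>, \<open>V\<close>, where \<open>V\<close> is
  coprime to the modulus. The three factors of the modulus are pairwise coprime, and each divides \<open>N\<close>
  as soon as \<open>N\<close> vanishes at sufficiently many complex points: at \<open>(q, q ^ n)\<close>, at \<open>(q, q ^ (-n))\<close>, and at
  \<open>(z, a)\<close> for all \<open>n\<close>-th roots of unity \<open>z \<noteq> 1\<close> (the factor \<open>[n]\<close> has only simple roots).

  At \<open>a = q ^ n\<close> with \<open>n = 2 * m + 1\<close> the summand vanishes for \<open>m < k < n\<close>, so the double sum is the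
  square of \<open>c(0) + \<dots> + c(m)\<close>, which is \<open>q ^ (-m) * [n]\<close> by a terminating quadratic summation. The case
  \<open>a = q ^ (-n)\<close> follows since the summand is invariant under \<open>a \<mapsto> 1 / a\<close>. At a primitive \<open>d\<close>-th root
  of unity, \<open>d\<close> dividing \<open>n\<close>, the summand satisfies \<open>c(l * d + r) = t(l * d) * c(r)\<close> for a suitable \<open>t\<close>
  and again vanishes for \<open>d / 2 < r < d\<close>, so the double sum contains the factor
  \<open>(c(0) + \<dots> + c(d - 1))\<^sup>2\<close>. This is zero by another specialisation of the same summation, whose closed
  form has the factor \<open>1 - q ^ d\<close>.\<close>

section \<open>A terminating quadratic summation by a WZ pair\<close>

text \<open>Consecutive ratio of the series with parameters \<open>x\<close>, \<open>q\<^sup>2 * y / x\<close>, \<open>q / y\<close> (base \<open>q\<^sup>2\<close>); for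
  \<open>y = q ^ (2 * m + 1)\<close> the third parameter is \<open>q ^ (- 2 * m)\<close> and the series stops after \<open>k = m\<close>.
  It is the limit \<open>b \<longlongrightarrow> \<infinity>\<close> of Rahman's quadratic summation (Gasper--Rahman (3.8.12)) at \<open>a = q\<close>.\<close>

definition wz_ratio :: "'a::field \<Rightarrow> 'a \<Rightarrow> 'a \<Rightarrow> nat \<Rightarrow> 'a" where
  "wz_ratio x y q k =
     (1 - x * (q ^ k)\<^sup>2) * (x - y * q\<^sup>2 * (q ^ k)\<^sup>2) * (y - q * (q ^ k)\<^sup>2) * (1 - q * q ^ k) /
     (q * q ^ k * (1 - q\<^sup>2 * (q ^ k)\<^sup>2) * (x - q\<^sup>2 * q ^ k) * (y - x * q ^ k) * (1 - q * y * q ^ k))"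

definition wz_term :: "'a::field \<Rightarrow> 'a \<Rightarrow> 'a \<Rightarrow> nat \<Rightarrow> 'a" where
  "wz_term x y q k = (\<Prod>j<k. wz_ratio x y q j)"

text \<open>With \<open>X = q ^ k\<close>, \<open>Q = q ^ (2 * m + 2)\<close> and \<open>y = q ^ (2 * m + 3)\<close>, this is the quotient of the
  \<open>k\<close>-th summands for \<open>m\<close> and \<open>m + 1\<close>, up to the quotient of the two closed forms.\<close>

definition wz_quot :: "'a::field \<Rightarrow> 'a \<Rightarrow> 'a \<Rightarrow> 'a \<Rightarrow> 'a" where
  "wz_quot x Q y X = x * (x - y) * (Q - X\<^sup>2) * (1 - Q * X) * (1 - y * X) /
     ((x - y * X\<^sup>2) * (Q - 1) * (Q - x * X) * (y - x * X))"

text \<open>The WZ certificate: times \<open>wz_term x y q k\<close> at \<open>X = q ^ k\<close>, it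
  is the function whose forward difference in \<open>k\<close> equals the summand for
  \<open>m + 1\<close> minus the rescaled summand for \<open>m\<close>. Its factor
  \<open>1 - X^2\<close> vanishes at \<open>k = 0\<close>.\<close>

definition wz_cert :: "'a::field \<Rightarrow> 'a \<Rightarrow> 'a \<Rightarrow> 'a \<Rightarrow> 'a \<Rightarrow> 'a" where
  "wz_cert x q Q y X = X * (Q * y - x) * (1 - X\<^sup>2) * (x - q * X) * (1 - y * X) /
     ((x - y * X\<^sup>2) * (Q - 1) * (y - x * X))"

text \<open>In the application \<open>y0 = q ^ (2 * m + 1)\<close>. The values of
  \<open>wz_quot\<close> at \<open>X\<close> and \<open>q * X\<close> share several factors; the
  remaining ones give the quotient of the two term ratios.\<close>

lemma wz_quot_step:
  fixes x q y0 :: "'a::field" and k :: nat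
  defines "Q \<equiv> q * y0" and "y \<equiv> q\<^sup>2 * y0" and "X \<equiv> q ^ k"
  assumes "q \<noteq> 0" "1 - Q * X \<noteq> 0"  "1 - q * y * X \<noteq> 0" "y - x * X \<noteq> 0"
    "x - y * X\<^sup>2 \<noteq> 0" "x - y * q\<^sup>2 * X\<^sup>2 \<noteq> 0"
  shows "wz_quot x Q y X * wz_ratio x y0 q k = wz_quot x Q y (q * X) * wz_ratio x y q k"
proof -
  define b where "b = x - y * X\<^sup>2"
  define b' where "b' = x - y * q\<^sup>2 * X\<^sup>2"
  define c where "c = Q - X\<^sup>2"
  define c' where "c' = Q - q\<^sup>2 * X\<^sup>2"
  define d where "d = Q - x * X"
  define e where "e = y - x * X"
  define f where "f = y0 - x * X"
  define a1 where "a1 = 1 - Q * X"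
  define a2 where "a2 = 1 - y * X"
  define a3 where "a3 = 1 - q * y * X"
  have nz: "q \<noteq> 0" "a1 \<noteq> 0" "a3 \<noteq> 0" "b \<noteq> 0" "b' \<noteq> 0" "e \<noteq> 0"
    using assms by (simp_all add: b_def b'_def e_def a1_def a3_def)
  have l1: "wz_quot x Q y X = x * (x - y) * c * a1 * a2 / (b * (Q - 1) * d * e)"
    unfolding wz_quot_def b_def c_def d_def e_def a1_def a2_def ..
  have "Q - (q * X)\<^sup>2 = c'" "1 - Q * (q * X) = a2" "1 - y * (q * X) = a3" "x - y * (q * X)\<^sup>2 = b'"
    "Q - x * (q * X) = q * f" "y - x * (q * X) = q * d"
    by (simp_all add: b'_def c'_def a2_def a3_def f_def d_def Q_def y_def algebra_simps power2_eq_square)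
  hence l2: "wz_quot x Q y (q * X) = x * (x - y) * c' * a2 * a3 / (b' * (Q - 1) * (q * f) * (q * d))"
    unfolding wz_quot_def by simp
  have "y - q * X\<^sup>2 = q * c"
    by (simp add: c_def Q_def y_def algebra_simps power2_eq_square)
  hence r2: "wz_ratio x y q k = (1 - x * X\<^sup>2) * b' * (q * c) * (1 - q * X) /
     (q * X * (1 - q\<^sup>2 * X\<^sup>2) * (x - q\<^sup>2 * X) * e * a3)"
    unfolding wz_ratio_def b'_def e_def a3_def X_def by simp
  have "q * (y0 - q * X\<^sup>2) = c'" "x - y0 * q\<^sup>2 * X\<^sup>2 = b" "1 - q * y0 * X = a1"
    by (simp_all add: c'_def b_def a1_def Q_def y_def algebra_simps power2_eq_square)
  moreover from this have "y0 - q * X\<^sup>2 = c' / q" using nz by (metis nonzero_mult_div_cancel_left)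
  ultimately have r1: "wz_ratio x y0 q k = (1 - x * X\<^sup>2) * b * (c' / q) * (1 - q * X) /
     (q * X * (1 - q\<^sup>2 * X\<^sup>2) * (x - q\<^sup>2 * X) * f * a1)"
    unfolding wz_ratio_def f_def X_def by simp
  \<comment> \<open>\<open>Q - 1\<close>, \<open>d\<close> and \<open>f\<close> stand in a
    denominator on both sides; if one of them is 0, both sides are 0 by the convention for
    division.\<close>
  show ?thesis
    unfolding l1 l2 r1 r2 using nz by (simp add: divide_simps)
qed

lemma wz_quot_1:
  assumes "x \<noteq> y" "Q \<noteq> 1"
  shows "wz_quot x Q y 1 = x * (1 - Q) * (1 - y) / ((x - Q) * (x - y))"
proof -
  have "wz_quot x Q y 1 = ((x - y) * (Q - 1)) * (x * (1 - Q) * (1 - y)) / (((x - y) * (Q - 1)) * ((Q - x) * (y - x)))"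
    unfolding wz_quot_def by (simp only: mult_ac power_one mult_1_left mult_1_right)
  also have "\<dots> = x * (1 - Q) * (1 - y) / ((Q - x) * (y - x))"
    using assms by (subst mult_divide_mult_cancel_left) auto
  also have "(Q - x) * (y - x) = (x - Q) * (x - y)" by (simp add: algebra_simps)
  finally show ?thesis .
qed

text \<open>The certificate equation of \<open>wz_step\<close> with its denominators
  cleared.\<close>

lemma wz_poly_identity:
  fixes x q X y Q :: "'a::field"
  assumes "y = q * Q"
  shows "(1 - q * X ^ 3) * ((x - y * X\<^sup>2) * (Q - 1) * (Q - x * X) * (y - x * X)
      - x * (x - y) * (Q - X\<^sup>2) * (1 - Q * X) * (1 - y * X))
    = (Q * y - x) * (1 - x * X\<^sup>2) * (Q - X\<^sup>2) * (1 - q * X) * (x - y * X\<^sup>2)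
      - X * (Q * y - x) * (1 - X\<^sup>2) * (x - q * X) * (1 - y * X) * (Q - x * X)"
  unfolding assms by (simp add: algebra_simps power2_eq_square power3_eq_cube)

text \<open>The WZ equation divided by \<open>wz_term x y q k\<close>; the factor
  \<open>1 - q * X ^ 3\<close> is \<open>1 - q ^ (3 * k + 1)\<close>.\<close>

lemma wz_step:
  fixes x q y0 :: "'a::field" and k :: nat
  defines "Q \<equiv> q * y0" and "y \<equiv> q\<^sup>2 * y0" and "X \<equiv> q ^ k"
  assumes nz: "q \<noteq> 0" "Q \<noteq> 1" "1 - q * y * X \<noteq> 0" "1 - q\<^sup>2 * X\<^sup>2 \<noteq> 0" "x - q\<^sup>2 * X \<noteq> 0"
    "Q - x * X \<noteq> 0" "y - x * X \<noteq> 0"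
    "x - y * X\<^sup>2 \<noteq> 0" "x - y * q\<^sup>2 * X\<^sup>2 \<noteq> 0"
  shows "(1 - q * X ^ 3) * (1 - wz_quot x Q y X)
    = wz_cert x q Q y (q * X) * wz_ratio x y q k - wz_cert x q Q y X"
proof -
  define D where "D = (x - y * X\<^sup>2) * (Q - 1) * (Q - x * X) * (y - x * X)"
  have X: "X \<noteq> 0" using nz by (simp add: X_def)
  have D: "D \<noteq> 0" using nz by (simp add: D_def)
  have eqs: "y - q * X\<^sup>2 = q * (Q - X\<^sup>2)" "y - x * (q * X) = q * (Q - x * X)"
    "(q * X)\<^sup>2 = q\<^sup>2 * X\<^sup>2" "x - y * (q\<^sup>2 * X\<^sup>2) = x - y * q\<^sup>2 * X\<^sup>2" "x - q * (q * X) = x - q\<^sup>2 * X"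
    "1 - y * (q * X) = 1 - q * y * X"
    by (simp_all add: Q_def y_def algebra_simps power2_eq_square)
  have "wz_cert x q Q y (q * X) * wz_ratio x y q k
     = (q * X * (Q * y - x) * (1 - q\<^sup>2 * X\<^sup>2) * (x - q\<^sup>2 * X) * (1 - q * y * X) /
     ((x - y * q\<^sup>2 * X\<^sup>2) * (Q - 1) * (q * (Q - x * X)))) *
     ((1 - x * X\<^sup>2) * (x - y * q\<^sup>2 * X\<^sup>2) * (q * (Q - X\<^sup>2)) * (1 - q * X) /
     (q * X * (1 - q\<^sup>2 * X\<^sup>2) * (x - q\<^sup>2 * X) * (y - x * X) * (1 - q * y * X)))"
    unfolding wz_cert_def wz_ratio_def X_def[symmetric] eqs ..
  also have "\<dots> = (Q * y - x) * (1 - x * X\<^sup>2) * (Q - X\<^sup>2) * (1 - q * X) / ((Q - 1) * (Q - x * X) * (y - x * X))"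
  proof -
    \<comment> \<open>Stated for independent variables, so that factors cancel without being
      expanded.\<close>
    have gen: "(q * X * n * p1 * p2 * p3 / (p4 * p5 * (q * p6))) * (m1 * p4 * (q * m2) * m3 / (q * X * p1 * p2 * p7 * p3))
       = n * m1 * m2 * m3 / (p5 * p6 * p7)" if "p1 \<noteq> 0" "p2 \<noteq> 0" "p3 \<noteq> 0" "p4 \<noteq> 0"
       for n p1 p2 p3 p4 p5 p6 p7 m1 m2 m3 :: 'a
      using that X nz(1) by (simp add: divide_simps)
    show ?thesis by (rule gen) (use nz in auto)
  qed
  also have "\<dots> = (Q * y - x) * (1 - x * X\<^sup>2) * (Q - X\<^sup>2) * (1 - q * X) * (x - y * X\<^sup>2) / D"
    using nz(8) by (simp add: D_def mult.assoc)
  finally have 1: "wz_cert x q Q y (q * X) * wz_ratio x y q k = \<dots>" .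
  have 2: "wz_cert x q Q y X = X * (Q * y - x) * (1 - X\<^sup>2) * (x - q * X) * (1 - y * X) * (Q - x * X) / D"
    using nz(6) by (simp add: D_def wz_cert_def mult.assoc)
  have 3: "1 - wz_quot x Q y X = (D - x * (x - y) * (Q - X\<^sup>2) * (1 - Q * X) * (1 - y * X)) / D"
    using D by (simp add: wz_quot_def D_def diff_divide_distrib)
  show ?thesis
    unfolding 1 2 3 unfolding times_divide_eq_right diff_divide_distrib[symmetric]
    unfolding D_def by (subst wz_poly_identity) (simp_all add: y_def Q_def power2_eq_square)
qed


text \<open>Keeps the denominators of the recursion in \<open>m\<close> nonzero. All odd exponents
  are excluded because of \<open>x - y * X^2\<close>, where \<open>y\<close> is an odd power of
  \<open>q\<close>; even exponents above \<open>n\<close> must stay allowed, since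
  \<open>x = q ^ (2 * m + 2)\<close> is used later with \<open>n = 2 * m + 1\<close>.\<close>

definition wz_nondeg :: "'a::field \<Rightarrow> 'a \<Rightarrow> nat \<Rightarrow> bool" where
  "wz_nondeg q x n \<longleftrightarrow> q \<noteq> 0 \<and> x \<noteq> 0 \<and> (\<forall>j>0. q ^ j \<noteq> 1) \<and>
     (\<forall>j>0. j \<le> n \<or> odd j \<longrightarrow> x \<noteq> q ^ j)"

text \<open>\<open>wz_quot_step\<close> telescopes over the first \<open>k\<close> ratios. The
  constant \<open>wz_quot x Q y 1\<close> is the quotient of the closed forms for
  \<open>m + 1\<close> and \<open>m\<close>.\<close>

lemma wz_quot_term:
  fixes q x :: "'a::field"
  assumes nd: "wz_nondeg q x (2 * m + 3)" and k: "k \<le> m + 1"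
  defines "Q \<equiv> q ^ (2 * m + 2)" and "y \<equiv> q ^ (2 * m + 3)"
  shows "wz_quot x Q y (q ^ k) * wz_term x y q k = wz_quot x Q y 1 * wz_term x (q ^ (2 * m + 1)) q k"
  using k
proof (induction k)
  case 0
  show ?case by (simp add: wz_term_def)
next
  case (Suc k)
  have q0: "q \<noteq> 0" and q1: "\<And>j. j > 0 \<Longrightarrow> q ^ j \<noteq> 1" using nd by (auto simp: wz_nondeg_def)
  have x: "x \<noteq> q ^ j" if "j > 0" "j \<le> 2 * m + 3 \<or> odd j" for j using nd that by (auto simp: wz_nondeg_def)
  have Qy: "Q = q * q ^ (2 * m + 1)" "y = q\<^sup>2 * q ^ (2 * m + 1)"
    by (simp_all add: Q_def y_def power_add power2_eq_square power3_eq_cube)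
  have "wz_quot x Q y (q ^ k) * wz_ratio x (q ^ (2 * m + 1)) q k = wz_quot x Q y (q * q ^ k) * wz_ratio x y q k"
    unfolding Qy
  proof (rule wz_quot_step, unfold Qy[symmetric])
    show "q \<noteq> 0" by (fact q0)
    show "1 - Q * q ^ k \<noteq> 0" using q1[of "2 * m + 2 + k"] by (simp add: Q_def power_add mult_ac)
    show "1 - q * y * q ^ k \<noteq> 0" using q1[of "2 * m + 4 + k"] by (simp add: y_def power_add mult_ac eval_nat_numeral)
    have "x \<noteq> q ^ (2 * m + 3 - k)" by (rule x) (use Suc.prems in auto)
    hence "q ^ k * x \<noteq> q ^ k * q ^ (2 * m + 3 - k)" using q0 by simp
    thus "y - x * q ^ k \<noteq> 0" using Suc.prems by (simp add: y_def mult.commute flip: power_add)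
    show "x - y * (q ^ k)\<^sup>2 \<noteq> 0" using x[of "2 * m + 3 + 2 * k"] by (simp add: y_def power_add power_even_eq)
    have "x \<noteq> q ^ (2 * m + 3 + 2 + 2 * k)" by (rule x) auto
    thus "x - y * q\<^sup>2 * (q ^ k)\<^sup>2 \<noteq> 0" by (simp only: y_def power_add power_even_eq right_minus_eq not_False_eq_True)
  qed
  note step = this
  have IH: "wz_quot x Q y (q ^ k) * wz_term x y q k = wz_quot x Q y 1 * wz_term x (q ^ (2 * m + 1)) q k"
    using Suc by simp
  have "wz_quot x Q y (q ^ Suc k) * wz_term x y q (Suc k) = wz_quot x Q y (q * q ^ k) * wz_ratio x y q k * wz_term x y q k"
    by (simp only: wz_term_def prod.lessThan_Suc power_Suc mult_ac)
  also have "\<dots> = wz_ratio x (q ^ (2 * m + 1)) q k * (wz_quot x Q y (q ^ k) * wz_term x y q k)"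
    unfolding step[symmetric] by (simp only: mult_ac)
  also have "\<dots> = wz_quot x Q y 1 * wz_term x (q ^ (2 * m + 1)) q (Suc k)"
    unfolding IH by (simp only: wz_term_def prod.lessThan_Suc mult_ac)
  finally show ?case .
qed

text \<open>Summing the WZ equation telescopes. The lower boundary term vanishes by the certificate,
  the upper one because the series has stopped.\<close>

lemma wz_sum_step:
  fixes q x :: "'a::field"
  assumes nd: "wz_nondeg q x (2 * m + 3)"
  defines "Q \<equiv> q ^ (2 * m + 2)" and "y \<equiv> q ^ (2 * m + 3)"
  shows "(\<Sum>k\<le>m+1. (1 - q ^ (3 * k + 1)) * wz_term x y q k) =
    x * (1 - Q) * (1 - y) / ((x - Q) * (x - y)) * (\<Sum>k\<le>m. (1 - q ^ (3 * k + 1)) * wz_term x (q ^ (2 * m + 1)) q k)"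
    (is "?L = ?r * ?R")
proof -
  have q0: "q \<noteq> 0" and q1: "\<And>j. j > 0 \<Longrightarrow> q ^ j \<noteq> 1" using nd by (auto simp: wz_nondeg_def)
  have x: "x \<noteq> q ^ j" if "j > 0" "j \<le> 2 * m + 3 \<or> odd j" for j using nd that by (auto simp: wz_nondeg_def)
  have Qy: "Q = q * q ^ (2 * m + 1)" "y = q\<^sup>2 * q ^ (2 * m + 1)"
    by (simp_all add: Q_def y_def power_add power2_eq_square power3_eq_cube)
  let ?u = "wz_term x y q" and ?v = "wz_term x (q ^ (2 * m + 1)) q"
  let ?g = "\<lambda>k. wz_cert x q Q y (q ^ k) * ?u k"
  have r: "?r = wz_quot x Q y 1"
    by (subst wz_quot_1) (use x[of "2*m+3"] q1[of "2*m+2"] in \<open>auto simp: Q_def y_def\<close>)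
  have step: "(1 - q ^ (3 * k + 1)) * ?u k - ?r * ((1 - q ^ (3 * k + 1)) * ?v k) = ?g (Suc k) - ?g k" if k: "k \<le> m + 1" for k
  proof -
    have s: "(1 - q * (q ^ k) ^ 3) * (1 - wz_quot x Q y (q ^ k))
      = wz_cert x q Q y (q * q ^ k) * wz_ratio x y q k - wz_cert x q Q y (q ^ k)"
      unfolding Qy
    proof (rule wz_step, unfold Qy[symmetric])
      show "q \<noteq> 0" by (fact q0)
      show "Q \<noteq> 1" using q1[of "2 * m + 2"] by (simp add: Q_def)
      show "1 - q * y * q ^ k \<noteq> 0" using q1[of "2 * m + 4 + k"] by (simp add: y_def power_add mult_ac eval_nat_numeral)
      show "1 - q\<^sup>2 * (q ^ k)\<^sup>2 \<noteq> 0" using q1[of "2 + 2 * k"] by (simp add: power_add power_even_eq del: add_2_eq_Suc add_2_eq_Suc')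
      show "x - q\<^sup>2 * q ^ k \<noteq> 0" using x[of "k + 2"] k by (simp add: power2_eq_square mult_ac)
      have "x \<noteq> q ^ (2 * m + 2 - k)" by (rule x) (use k in auto)
      hence "q ^ k * x \<noteq> q ^ k * q ^ (2 * m + 2 - k)" using q0 by simp
      thus "Q - x * q ^ k \<noteq> 0" using k by (simp add: Q_def mult.commute flip: power_add)
      have "x \<noteq> q ^ (2 * m + 3 - k)" by (rule x) (use k in auto)
      hence "q ^ k * x \<noteq> q ^ k * q ^ (2 * m + 3 - k)" using q0 by simp
      thus "y - x * q ^ k \<noteq> 0" using k by (simp add: y_def mult.commute flip: power_add)
      show "x - y * (q ^ k)\<^sup>2 \<noteq> 0" using x[of "2 * m + 3 + 2 * k"] by (simp add: y_def power_add power_even_eq)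
      have "x \<noteq> q ^ (2 * m + 3 + 2 + 2 * k)" by (rule x) auto
      thus "x - y * q\<^sup>2 * (q ^ k)\<^sup>2 \<noteq> 0" by (simp only: y_def power_add power_even_eq right_minus_eq not_False_eq_True)
    qed
    have qk: "1 - q ^ (3 * k + 1) = 1 - q * (q ^ k) ^ 3" by (simp flip: power_mult add: mult.commute)
    have rv: "?r * ?v k = wz_quot x Q y (q ^ k) * ?u k"
      unfolding r using wz_quot_term[OF nd k] by (simp add: Q_def y_def)
    have "(1 - q ^ (3 * k + 1)) * ?u k - ?r * ((1 - q ^ (3 * k + 1)) * ?v k)
       = (1 - q ^ (3 * k + 1)) * ?u k - (1 - q ^ (3 * k + 1)) * (?r * ?v k)" by (simp only: mult_ac)
    also have "\<dots> = (1 - q * (q ^ k) ^ 3) * (1 - wz_quot x Q y (q ^ k)) * ?u k"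
      unfolding rv qk by (simp only: algebra_simps mult_1_left mult_1_right)
    also have "\<dots> = wz_cert x q Q y (q * q ^ k) * (?u k * wz_ratio x y q k) - ?g k"
      unfolding s unfolding left_diff_distrib by (simp only: mult_ac)
    also have "?u k * wz_ratio x y q k = ?u (Suc k)" by (simp add: wz_term_def)
    finally show ?thesis by simp
  qed
  \<comment> \<open>The factor \<open>y - q * X^2\<close> of the ratio is 0 here, which stops the
    series.\<close>
  have vanish: "wz_ratio x z q j = 0" if "z = q ^ (2 * j + 1)" for z j
    unfolding wz_ratio_def that by (simp add: power_even_eq)
  have "2 * m + 3 = 2 * (m + 1) + 1" by simp
  hence "wz_ratio x y q (m + 1) = 0" unfolding y_def by (intro vanish) (simp only:)
  hence u: "?u (Suc (m + 1)) = 0"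
    by (simp only: wz_term_def prod.lessThan_Suc mult_zero_right)
  \<comment> \<open>The series for \<open>m\<close> stops one term earlier, so its sum may be
    extended to \<open>m + 1\<close>.\<close>
  have "?v (m + 1) = 0"
    by (simp add: wz_term_def vanish)
  hence v: "(\<Sum>k\<le>m+1. (1 - q ^ (3 * k + 1)) * ?v k) = ?R"
    by simp
  have "?L - ?r * (\<Sum>k\<le>m+1. (1 - q ^ (3 * k + 1)) * ?v k) = (\<Sum>k<Suc (m+1). ?g (Suc k) - ?g k)"
    unfolding sum_distrib_left sum_subtractf[symmetric] lessThan_Suc_atMost
    by (intro sum.cong refl step) simp
  also have "\<dots> = ?g (Suc (m + 1)) - ?g 0" by (rule sum_lessThan_telescope)
  also have "\<dots> = 0" unfolding u by (simp add: wz_cert_def)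
  finally show ?thesis unfolding v by (simp only: right_minus_eq)
qed

lemma wz_nondeg_mono: "wz_nondeg q x n \<Longrightarrow> m \<le> n \<Longrightarrow> wz_nondeg q x m"
  by (auto simp: wz_nondeg_def)

text \<open>Iterates \<open>wz_sum_step\<close>; each step contributes one \<open>x\<close> and the
  factors \<open>j = 2 * m + 2\<close> and \<open>j = 2 * m + 3\<close>.\<close>

lemma wz_sum:
  fixes q x :: "'a::field"
  assumes "wz_nondeg q x (2 * m + 1)"
  shows "(\<Sum>k\<le>m. (1 - q ^ (3 * k + 1)) * wz_term x (q ^ (2 * m + 1)) q k) =
    (1 - q) * x ^ m * (\<Prod>j=2..2*m+1. (1 - q ^ j) / (x - q ^ j))"
  using assms
proof (induction m)
  case 0
  show ?case by (simp add: wz_term_def)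
next
  case (Suc m)
  have nd: "wz_nondeg q x (2 * m + 3)" using Suc.prems by (simp add: numeral_3_eq_3)
  have e: "{2..2 * m + 3} = insert (2*m+3) (insert (2*m+2) {2..2*m+1})" by auto
  have i: "2 * Suc m + 1 = 2 * m + 3" by simp
  have IH: "(\<Sum>k\<le>m. (1 - q ^ (3 * k + 1)) * wz_term x (q ^ (2 * m + 1)) q k) =
    (1 - q) * x ^ m * (\<Prod>j=2..2*m+1. (1 - q ^ j) / (x - q ^ j))"
    by (intro Suc.IH wz_nondeg_mono[OF nd]) simp
  show ?case
    unfolding i unfolding Suc_eq_plus1 wz_sum_step[OF nd] IH e
    by (simp add: mult_ac)
qed

section \<open>The summand\<close>

text \<open>\<open>qbinom_add q n k\<close> is the Gaussian binomial coefficient with upper entry \<open>n + k\<close> and lower entry \<open>k\<close>.\<close>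

fun qbinom_add :: "'a::comm_ring_1 \<Rightarrow> nat \<Rightarrow> nat \<Rightarrow> 'a" where
  "qbinom_add q n 0 = 1"
| "qbinom_add q 0 (Suc k) = 1"
| "qbinom_add q (Suc n) (Suc k) = qbinom_add q (Suc n) k + q ^ Suc k * qbinom_add q n (Suc k)"

text \<open>The two absorption rules are proved together: each follows from the recursion and both
  rules at a smaller \<open>n + k\<close>.\<close>

lemma qbinom_add_absorb:
  fixes q :: "'a::comm_ring_1"
  shows "(1 - q ^ Suc k) * qbinom_add q n (Suc k) = (1 - q ^ Suc (n + k)) * qbinom_add q n k \<and>
         (1 - q ^ Suc n) * qbinom_add q (Suc n) k = (1 - q ^ Suc (n + k)) * qbinom_add q n k"
proof (induction "n + k" arbitrary: n k)
  case 0
  thus ?case by simp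
next
  case (Suc s)
  have 1: "(1 - q ^ Suc k) * qbinom_add q n (Suc k) = (1 - q ^ Suc (n + k)) * qbinom_add q n k"
  proof (cases n)
    case 0
    thus ?thesis by (cases k) auto
  next
    case (Suc n')
    with Suc.hyps have s: "s = n' + k" by simp
    note IH = Suc.hyps(1)[OF s]
    have "(1 - q ^ Suc k) * qbinom_add q n (Suc k) = (1 - q ^ Suc k) * qbinom_add q (Suc n') k
       + q ^ Suc k * ((1 - q ^ Suc k) * qbinom_add q n' (Suc k))"
      unfolding Suc by (simp only: qbinom_add.simps ring_distribs mult_ac)
    also have "(1 - q ^ Suc k) * qbinom_add q n' (Suc k) = (1 - q ^ Suc n') * qbinom_add q (Suc n') k"
      using IH by simp
    also have "(1 - q ^ Suc k) * qbinom_add q (Suc n') k + q ^ Suc k * ((1 - q ^ Suc n') * qbinom_add q (Suc n') k)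
        = (1 - q ^ Suc (n + k)) * qbinom_add q n k"
      unfolding Suc by (simp add: algebra_simps power_add)
    finally show ?thesis .
  qed
  have 2: "(1 - q ^ Suc n) * qbinom_add q (Suc n) k = (1 - q ^ Suc (n + k)) * qbinom_add q n k"
  proof (cases k)
    case 0
    thus ?thesis by (cases n) auto
  next
    case (Suc k')
    with Suc.hyps have s: "s = n + k'" by simp
    note IH = Suc.hyps(1)[OF s]
    have "(1 - q ^ Suc n) * qbinom_add q (Suc n) k = (1 - q ^ Suc n) * qbinom_add q (Suc n) k'
       + q ^ Suc k' * ((1 - q ^ Suc n) * qbinom_add q n (Suc k'))"
      unfolding Suc by (simp only: qbinom_add.simps ring_distribs mult_ac)
    also have "(1 - q ^ Suc n) * qbinom_add q (Suc n) k' = (1 - q ^ Suc k') * qbinom_add q n (Suc k')"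
      using IH by simp
    also have "(1 - q ^ Suc k') * qbinom_add q n (Suc k') + q ^ Suc k' * ((1 - q ^ Suc n) * qbinom_add q n (Suc k'))
        = (1 - q ^ Suc (n + k)) * qbinom_add q n k"
      unfolding Suc by (simp add: algebra_simps power_add)
    finally show ?thesis .
  qed
  show ?case using 1 2 ..
qed

text \<open>One absorption in each index, then \<open>1 - q ^ (2 * k + 2)\<close> is factored as a
  difference of squares and a common factor cancels.\<close>

lemma central_qbinom_Suc:
  fixes q :: "'a::idom"
  assumes "q ^ Suc k \<noteq> 1"
  shows "(1 - q ^ Suc k) * qbinom_add q (Suc k) (Suc k)
    = (1 - q ^ (2 * k + 1)) * (1 + q ^ Suc k) * qbinom_add q k k"
proof -
  let ?b = "1 - q ^ Suc k"
  have "?b * (?b * qbinom_add q (Suc k) (Suc k)) = ?b * ((1 - q ^ Suc (Suc k + k)) * qbinom_add q (Suc k) k)"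
    using qbinom_add_absorb[of q k "Suc k"] by simp
  also have "\<dots> = (1 - q ^ Suc (Suc k + k)) * ((1 - q ^ Suc (k + k)) * qbinom_add q k k)"
    using qbinom_add_absorb[of q k k, THEN conjunct2] by (metis mult.left_commute)
  also have "(1 - q ^ Suc (Suc k + k)) = ?b * (1 + q ^ Suc k)"
    by (simp add: algebra_simps power_add)
  finally have "?b * (?b * qbinom_add q (Suc k) (Suc k)) = ?b * ((1 - q ^ Suc (k + k)) * (1 + q ^ Suc k) * qbinom_add q k k)"
    by (simp only: mult_ac)
  moreover have "?b \<noteq> 0" using assms by simp
  moreover have "Suc (k + k) = 2 * k + 1" by simp
  ultimately show ?thesis by (simp only: mult_left_cancel not_False_eq_True)
qed

text \<open>The quotient \<open>(q; q\<^sup>2)\<^sub>k / (q\<^sup>2; q\<^sup>2)\<^sub>k\<close> equals the central Gaussian binomial coefficient divided by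
  \<open>(-q; q)\<^sub>k\<^sup>2\<close>. In this form the denominator of the summand is coprime to \<open>[n]\<close> for odd \<open>n\<close>, and the
  summand can be evaluated at roots of unity.\<close>

definition t_num :: "'a::comm_ring_1 \<Rightarrow> 'a \<Rightarrow> nat \<Rightarrow> 'a" where
  "t_num q a k = qbinom_add q k k * (\<Prod>i<k. (1 - a * q ^ (2 * i + 1)) * (a - q ^ (2 * i + 1)))"

text \<open>The factors \<open>q ^ Suc i\<close> collect the power of \<open>q\<close> with binomial
  exponent. Here and in \<open>t_num\<close>, \<open>a - q ^ j\<close> replaces
  \<open>1 - q ^ j / a\<close>, so that both are polynomials.\<close>

definition t_den :: "'a::comm_ring_1 \<Rightarrow> 'a \<Rightarrow> nat \<Rightarrow> 'a" where
  "t_den q a k = (\<Prod>i<k. q ^ Suc i * (1 + q ^ Suc i)\<^sup>2 * ((1 - a * q ^ Suc i) * (a - q ^ Suc i)))"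

definition t_ratio :: "'a::field \<Rightarrow> 'a \<Rightarrow> nat \<Rightarrow> 'a" where
  "t_ratio q a k = (1 - q ^ (2 * k + 1)) * (1 - a * q ^ (2 * k + 1)) * (a - q ^ (2 * k + 1)) /
     (q ^ Suc k * (1 - q ^ (2 * k + 2)) * (1 - a * q ^ Suc k) * (a - q ^ Suc k))"

definition t_val :: "'a::field \<Rightarrow> 'a \<Rightarrow> nat \<Rightarrow> 'a" where
  "t_val q a k = t_num q a k / t_den q a k"

lemma t_val_0 [simp]: "t_val q a 0 = 1"
  by (simp add: t_val_def t_num_def t_den_def)

lemma t_val_Suc:
  assumes "q ^ Suc k \<noteq> 1"
  shows "t_val q a (Suc k) = t_val q a k * t_ratio q a k"
proof -
  let ?b = "1 - q ^ Suc k" and ?c = "1 + q ^ Suc k"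
  let ?N = "(1 - a * q ^ (2 * k + 1)) * (a - q ^ (2 * k + 1))"
  let ?P = "\<Prod>i<k. (1 - a * q ^ (2 * i + 1)) * (a - q ^ (2 * i + 1))"
  let ?D = "(1 - a * q ^ Suc k) * (a - q ^ Suc k)"
  have b: "?b \<noteq> 0" using assms by simp
  have g: "qbinom_add q (Suc k) (Suc k) = (1 - q ^ (2 * k + 1)) * ?c * qbinom_add q k k / ?b"
    using central_qbinom_Suc[OF assms] by (subst nonzero_eq_divide_eq[OF b]) (simp only: mult.commute[of _ ?b])
  have bc: "1 - q ^ (2 * k + 2) = ?b * ?c"
    by (simp add: algebra_simps power_add mult_2 mult_2_right)
  have "t_val q a (Suc k) = qbinom_add q (Suc k) (Suc k) * (?P * ?N) / (t_den q a k * (q ^ Suc k * ?c\<^sup>2 * ?D))"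
    by (simp only: t_val_def t_num_def t_den_def prod.lessThan_Suc)
  also have "\<dots> = qbinom_add q k k * ?P / t_den q a k * ((1 - q ^ (2 * k + 1)) * ?N / (q ^ Suc k * (?b * ?c) * ?D))"
    unfolding g power2_eq_square by (cases "?c = 0") (simp_all add: divide_simps del: power_Suc)
  also have "\<dots> = t_val q a k * t_ratio q a k"
    by (simp only: t_val_def t_num_def t_ratio_def bc mult.assoc)
  finally show ?thesis .
qed

text \<open>The parameters \<open>x\<close>, \<open>q^2 * y / x\<close>, \<open>q / y\<close> become
  \<open>q * a\<close>, \<open>q\<close>, \<open>q / a\<close>, those of the summand;
  \<open>q / a\<close> is the terminating one.\<close>

lemma wz_ratio_eq_t_ratio_1:
  assumes "q \<noteq> 0" "a \<noteq> 0" "q ^ Suc k \<noteq> 1"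
  shows "wz_ratio (q * a) a q k = t_ratio q a k"
proof -
  define X where "X = q ^ k"
  have e: "q * a - a * q\<^sup>2 * X\<^sup>2 = q * a * (1 - q * X\<^sup>2)" "q * a - q\<^sup>2 * X = q * (a - q * X)" "a - q * a * X = a * (1 - q * X)"
    "1 - q * a * X\<^sup>2 = 1 - a * (q * X\<^sup>2)" "1 - q * a * X = 1 - a * (q * X)"
    by (simp_all add: algebra_simps power2_eq_square)
  have X: "q ^ (2 * k + 1) = q * X\<^sup>2" "q ^ (2 * k + 2) = q\<^sup>2 * X\<^sup>2" "q ^ Suc k = q * X"
    by (simp_all add: X_def power_even_eq power2_eq_square)
  have nz: "1 - q * X \<noteq> 0" using assms by (simp add: X_def)
  show ?thesis
    unfolding wz_ratio_def t_ratio_def X X_def[symmetric] e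
    using assms nz by (simp add: divide_simps)
qed

text \<open>The same parameters in the order \<open>q / a\<close>, \<open>q * a\<close>,
  \<open>q\<close>; now \<open>q\<close> is the terminating one, which suits roots of unity.\<close>

lemma wz_ratio_eq_t_ratio_2:
  assumes "q \<noteq> 0" "a \<noteq> 0" "q ^ Suc k \<noteq> 1"
  shows "wz_ratio (q / a) 1 q k = t_ratio q a k"
proof -
  define X where "X = q ^ k"
  have e: "q / a - 1 * q\<^sup>2 * X\<^sup>2 = q * (1 - a * (q * X\<^sup>2)) / a" "q / a - q\<^sup>2 * X = q * (1 - a * (q * X)) / a"
    "1 - q / a * X = (a - q * X) / a" "1 - q / a * X\<^sup>2 = (a - q * X\<^sup>2) / a" "1 - q * 1 * X = 1 - q * X"
    using assms by (simp_all add: field_simps power2_eq_square)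
  have X: "q ^ (2 * k + 1) = q * X\<^sup>2" "q ^ (2 * k + 2) = q\<^sup>2 * X\<^sup>2" "q ^ Suc k = q * X"
    by (simp_all add: X_def power_even_eq power2_eq_square)
  have nz: "1 - q * X \<noteq> 0" using assms by (simp add: X_def)
  show ?thesis
    unfolding wz_ratio_def t_ratio_def X X_def[symmetric] e
    using assms nz by (simp add: divide_simps)
qed

lemma t_val_eq_wz_term:
  assumes "q \<noteq> 0" "a \<noteq> 0" "\<And>j. 0 < j \<Longrightarrow> j \<le> k \<Longrightarrow> q ^ j \<noteq> 1"
  shows "t_val q a k = wz_term (q * a) a q k" "t_val q a k = wz_term (q / a) 1 q k"
proof -
  have "t_val q a k = (\<Prod>j<k. t_ratio q a j)"
    using assms(3)
  proof (induction k)
    case (Suc k)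
    thus ?case by (simp add: t_val_Suc del: power_Suc)
  qed simp
  moreover have "q ^ Suc j \<noteq> 1" if "j < k" for j using assms(3)[of "Suc j"] that by simp
  moreover from this have "(\<Prod>j<k. t_ratio q a j) = (\<Prod>j<k. wz_ratio (q * a) a q j)"
    by (intro prod.cong refl wz_ratio_eq_t_ratio_1[symmetric]) (use assms(1,2) in auto)
  moreover from calculation(2) have "(\<Prod>j<k. t_ratio q a j) = (\<Prod>j<k. wz_ratio (q / a) 1 q j)"
    by (intro prod.cong refl wz_ratio_eq_t_ratio_2[symmetric]) (use assms(1,2) in auto)
  ultimately show "t_val q a k = wz_term (q * a) a q k" "t_val q a k = wz_term (q / a) 1 q k"
    by (simp_all add: wz_term_def)
qed


section \<open>Sums of the summand at \<open>a = q ^ (2 * m + 1)\<close> and at roots of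
  unity\<close>

lemma qint_geometric: "(1 - q) * qint q n = 1 - q ^ n" for q :: "'a::comm_ring_1"
  by (simp add: qint_def one_diff_power_eq)

text \<open>\<open>inj (power q)\<close> says that \<open>q\<close> is neither 0 nor a root of
  unity; it covers both the indeterminate and complex \<open>q\<close> with
  \<open>0 < norm q < 1\<close>.\<close>

lemma inj_powerD:
  fixes q :: "'a::field"
  assumes "inj (power q)"
  shows "q \<noteq> 0" "\<And>i j. q ^ i = q ^ j \<longleftrightarrow> i = j" "\<And>j. j > 0 \<Longrightarrow> q ^ j \<noteq> 1"
proof -
  show *: "q ^ i = q ^ j \<longleftrightarrow> i = j" for i j using assms by (simp add: inj_eq)
  show "q \<noteq> 0" using *[of 1 2] by auto
  show "q ^ j \<noteq> 1" if "j > 0" for j using *[of j 0] that by simp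
qed

lemma prod_minus_power: "(\<Prod>j=2..2*m+1. - (q ^ j)) = q ^ (m * (2 * m + 3))" for q :: "'a::comm_ring_1"
proof (induction m)
  case (Suc m)
  have e: "{2..2 * Suc m + 1} = insert (2*m+3) (insert (2*m+2) {2..2*m+1})" by auto
  have i: "Suc m * (2 * Suc m + 3) = (2 * m + 3) + ((2 * m + 2) + m * (2 * m + 3))"
    by (simp add: algebra_simps)
  have "(\<Prod>j=2..2*Suc m+1. - (q ^ j)) = - (q ^ (2 * m + 3)) * (- (q ^ (2 * m + 2)) * (\<Prod>j=2..2*m+1. - (q ^ j)))"
    unfolding e by simp
  also have "\<dots> = q ^ (Suc m * (2 * Suc m + 3))"
    unfolding Suc i by (simp only: power_add minus_mult_minus mult_minus_left mult_minus_right minus_minus)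
  finally show ?case .
qed simp

text \<open>Extract \<open>- (q ^ j)\<close> from each factor and reverse the order of the
  others.\<close>

lemma prod_diff_power:
  fixes q :: "'a::comm_ring_1"
  shows "(\<Prod>j=2..2*m+1. q ^ (2 * m + 2) - q ^ j) = q ^ (m * (2 * m + 3)) * (\<Prod>j=1..2*m. 1 - q ^ j)"
proof -
  have "(\<Prod>j=2..2*m+1. q ^ (2 * m + 2) - q ^ j) = (\<Prod>j=2..2*m+1. - (q ^ j) * (1 - q ^ (2 * m + 2 - j)))"
    by (intro prod.cong) (auto simp: algebra_simps simp flip: power_add)
  also have "\<dots> = q ^ (m * (2 * m + 3)) * (\<Prod>j=2..2*m+1. 1 - q ^ (2 * m + 2 - j))"
    by (simp only: prod.distrib prod_minus_power)
  also have "(\<Prod>j=2..2*m+1. 1 - q ^ (2 * m + 2 - j)) = (\<Prod>j=1..2*m. 1 - q ^ j)"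
    by (rule prod.reindex_bij_witness[of _ "\<lambda>j. 2 * m + 2 - j" "\<lambda>j. 2 * m + 2 - j"]) auto
  finally show ?thesis .
qed

text \<open>This is \<open>wz_sum\<close> at \<open>x = q * a = q ^ (2 * m + 2)\<close>: the
  products cancel up to \<open>1 - q ^ (2 * m + 1)\<close>, the powers of \<open>q\<close> up to
  \<open>q ^ m\<close> in the denominator.\<close>

lemma sum_t_val_a_eq_power:
  fixes q :: "'a::field"
  assumes "inj (power q)"
  shows "(\<Sum>k\<le>m. qint q (3 * k + 1) * t_val q (q ^ (2 * m + 1)) k) = qint q (2 * m + 1) / q ^ m"
proof -
  note q = inj_powerD[OF assms]
  let ?x = "q ^ (2 * m + 2)"
  have nd: "wz_nondeg q ?x (2 * m + 1)"
    using q by (auto simp: wz_nondeg_def simp del: power_Suc)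
  have q1: "1 - q \<noteq> 0" using q(3)[of 1] by simp
  have "(1 - q) * (\<Sum>k\<le>m. qint q (3 * k + 1) * t_val q (q ^ (2 * m + 1)) k)
    = (\<Sum>k\<le>m. (1 - q ^ (3 * k + 1)) * wz_term ?x (q ^ (2 * m + 1)) q k)"
    unfolding sum_distrib_left mult.assoc[symmetric] qint_geometric
    by (intro sum.cong refl, subst t_val_eq_wz_term(1)) (use q in auto)
  also have "\<dots> = (1 - q) * ?x ^ m * (\<Prod>j=2..2*m+1. (1 - q ^ j) / (?x - q ^ j))"
    by (rule wz_sum[OF nd])
  also have "\<dots> = ?x ^ m * ((1 - q) * (\<Prod>j=2..2*m+1. 1 - q ^ j)) / (q ^ (m * (2 * m + 3)) * (\<Prod>j=1..2*m. 1 - q ^ j))"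
    unfolding prod_dividef prod_diff_power by (simp only: times_divide_eq_right mult_ac)
  also have "(1 - q) * (\<Prod>j=2..2*m+1. 1 - q ^ j) = (1 - q ^ (2 * m + 1)) * (\<Prod>j=1..2*m. 1 - q ^ j)"
  proof -
    have "{1..2*m+1} = insert 1 {2..2*m+1}" "{1..2*m+1} = insert (2*m+1) {1..2*m}" by auto
    hence "prod f (insert 1 {2..2*m+1}) = prod f (insert (2*m+1) {1..2*m})" for f :: "nat \<Rightarrow> 'a" by simp
    from this[of "\<lambda>j. 1 - q ^ j"] show ?thesis by simp
  qed
  also have "?x ^ m * \<dots> / (q ^ (m * (2 * m + 3)) * (\<Prod>j=1..2*m. 1 - q ^ j)) = (1 - q ^ (2 * m + 1)) / q ^ m"
  proof -
    have "q ^ (m * (2 * m + 3)) = ?x ^ m * q ^ m"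
      by (simp add: algebra_simps flip: power_mult power_add)
    moreover have "(\<Prod>j=1..2*m. 1 - q ^ j) \<noteq> 0" using q(3) by auto
    ultimately show ?thesis using q(1) by simp
  qed
  also have "\<dots> = (1 - q) * (qint q (2 * m + 1) / q ^ m)"
    by (simp add: qint_geometric[symmetric] del: power_Suc)
  finally show ?thesis unfolding mult_left_cancel[OF q1] .
qed

text \<open>The ratio at index \<open>m\<close> has the factor \<open>y - q ^ (2 * m + 1)\<close>;
  the two alternatives use the parametrisations with \<open>y = a\<close> and
  \<open>y = 1\<close>.\<close>

lemma t_val_eq_0:
  assumes "q \<noteq> 0" "a \<noteq> 0" "\<And>j. 0 < j \<Longrightarrow> j \<le> k \<Longrightarrow> q ^ j \<noteq> 1" "m < k" "a = q ^ (2 * m + 1) \<or> q ^ (2 * m + 1) = 1"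
  shows "t_val q a k = 0"
proof -
  have "wz_ratio x (q ^ (2 * m + 1)) q m = 0" for x
    by (simp add: wz_ratio_def power_even_eq)
  thus ?thesis
    using assms t_val_eq_wz_term[OF assms(1-3)] unfolding wz_term_def
    by (metis finite_lessThan lessThan_iff prod_zero)
qed

text \<open>The WZ recursion in \<open>m\<close> breaks down at a root of unity \<open>z\<close>, so the summation is carried over
  by letting \<open>q\<close> tend to \<open>z\<close> from inside the unit disc.\<close>

lemma tendsto_wz_term:
  fixes f :: "'b \<Rightarrow> complex"
  assumes f: "(f \<longlongrightarrow> z) F" and z: "z \<noteq> 0" "z ^ n = 1" "\<And>j. 0 < j \<Longrightarrow> j < n \<Longrightarrow> z ^ j \<noteq> 1"
    and k: "2 * k < n" and x: "norm x > 1"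
  shows "((\<lambda>i. wz_term x (f i ^ n) (f i) k) \<longlongrightarrow> wz_term x 1 z k) F"
proof -
  have nz: "norm z = 1" using z(2) k by (metis norm_one norm_power norm_ge_zero power_eq_1_iff less_nat_zero_code bot_nat_0.not_eq_extremum)
  have x0: "x - z ^ j \<noteq> 0" "1 - x * z ^ j \<noteq> 0" for j
  proof -
    show "x - z ^ j \<noteq> 0" using x nz by (auto simp: norm_power)
    have "norm (x * z ^ j) \<noteq> norm (1::complex)" using x nz by (simp add: norm_mult norm_power)
    thus "1 - x * z ^ j \<noteq> 0" by auto
  qed
  have "((\<lambda>i. wz_ratio x (f i ^ n) (f i) j) \<longlongrightarrow> wz_ratio x (z ^ n) z j) F" if j: "j < k" for j
  proof -
    have e1: "z\<^sup>2 * (z ^ j)\<^sup>2 = z ^ (2 * j + 2)" by (simp only: power_add power_even_eq) (rule mult.commute)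
    have e2: "z\<^sup>2 * z ^ j = z ^ (j + 2)" by (simp only: power_add) (rule mult.commute)
    have e3: "z * 1 * z ^ j = z ^ (j + 1)" by simp
    \<comment> \<open>Since \<open>2 * k < n\<close>, both exponents lie strictly between 0 and
      \<open>n\<close>, so these denominator factors do not vanish in the limit.\<close>
    have "z ^ (2 * j + 2) \<noteq> 1" using z(3)[of "2 * j + 2"] j k by simp
    moreover have "z ^ (j + 1) \<noteq> 1" using z(3)[of "j + 1"] j k by simp
    ultimately have "z * z ^ j * (1 - z\<^sup>2 * (z ^ j)\<^sup>2) * (x - z\<^sup>2 * z ^ j) * (z ^ n - x * z ^ j) * (1 - z * z ^ n * z ^ j) \<noteq> 0"
      using z(1) x0(1)[of "j + 2"] x0(2)[of j] unfolding z(2) e1 e2 e3 by (simp del: power_Suc)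
    thus ?thesis unfolding wz_ratio_def
      by (intro tendsto_intros f)
  qed
  thus ?thesis unfolding wz_term_def z(2)[symmetric]
    by (intro tendsto_prod) auto
qed

text \<open>The closed form of \<open>wz_sum\<close> has the factor
  \<open>1 - q ^ (2 * m + 1)\<close>, which tends to 0, while \<open>norm x > 1\<close> keeps its
  denominators nonzero.\<close>

lemma sum_t_val_root_of_unity:
  fixes z a :: complex
  assumes z: "z ^ (2 * m + 1) = 1" "\<And>j. 0 < j \<Longrightarrow> j < 2 * m + 1 \<Longrightarrow> z ^ j \<noteq> 1"
    and m: "m > 0" and a: "a \<noteq> 0" "norm a < 1"
  shows "(\<Sum>k\<le>m. qint z (3 * k + 1) * t_val z a k) = 0"
proof -
  \<comment> \<open>\<open>x\<close> stays fixed while \<open>q = f i\<close> tends to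
    \<open>z\<close> radially; only the limit has the form \<open>x = q / a\<close>,
    \<open>y = 1\<close>. The shift by 2 in \<open>f\<close> gives \<open>0 < norm (f i) < 1\<close>
    already at \<open>i = 0\<close>.\<close>
  define x where "x = z / a"
  define f where "f i = of_real (1 - 1 / real (i + 2)) * z" for i :: nat
  have z0: "z \<noteq> 0" using z(1) by auto
  have nz: "norm z = 1" using z(1) by (metis norm_one norm_power norm_ge_zero power_eq_1_iff Suc_eq_plus1 nat.distinct(1))
  have z1: "1 - z \<noteq> 0" using z(2)[of 1] m by simp
  have x: "norm x > 1" using a nz by (simp add: x_def norm_divide)
  have "(\<lambda>i. 1 - 1 / real (i + 2)) \<longlonglongrightarrow> 1 - 0"
    by (intro tendsto_intros LIMSEQ_ignore_initial_segment[OF lim_1_over_n])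
  hence "f \<longlonglongrightarrow> of_real (1 - 0) * z" unfolding f_def
    by (rule tendsto_mult[OF tendsto_of_real tendsto_const])
  hence f: "f \<longlonglongrightarrow> z" by simp
  have nf: "0 < norm (f i)" "norm (f i) < 1" for i
  proof -
    have "norm (f i) = \<bar>1 - 1 / real (i + 2)\<bar>" unfolding f_def norm_mult norm_of_real nz by simp
    moreover have "0 < 1 / real (i + 2)" "1 / real (i + 2) < 1" by (simp_all add: field_simps)
    ultimately show "0 < norm (f i)" "norm (f i) < 1" by linarith+
  qed
  have nd: "wz_nondeg (f i) x (2 * m + 1)" for i
  proof -
    have p: "norm (f i ^ j) < 1" if "j > 0" for j
      using nf[of i] that by (simp add: norm_power power_less_one_iff)
    have "f i ^ j \<noteq> 1" if "j > 0" for j using p[OF that] by auto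
    moreover have "x \<noteq> f i ^ j" if "j > 0" for j using p[OF that] x by auto
    ultimately show ?thesis using nf[of i] x by (auto simp: wz_nondeg_def)
  qed
  let ?L = "\<lambda>y q. \<Sum>k\<le>m. (1 - q ^ (3 * k + 1)) * wz_term x y q k"
  let ?R = "\<lambda>q. (1 - q) * x ^ m * (\<Prod>j=2..2*m+1. (1 - q ^ j) / (x - q ^ j))"
  have "(\<lambda>i. ?L (f i ^ (2 * m + 1)) (f i)) \<longlonglongrightarrow> ?L 1 z"
    by (intro tendsto_intros f tendsto_wz_term z x z0) auto
  moreover have "x - z ^ j \<noteq> 0" for j using x nz by (auto simp: norm_power)
  hence "(\<lambda>i. ?R (f i)) \<longlonglongrightarrow> ?R z"
    by (intro tendsto_intros f)
  moreover have "?L (f i ^ (2 * m + 1)) (f i) = ?R (f i)" for i by (rule wz_sum[OF nd])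
  ultimately have "?L 1 z = ?R z" by (simp only: LIMSEQ_unique)
  moreover have "(\<Prod>j=2..2*m+1. (1 - z ^ j) / (x - z ^ j)) = 0"
    using m z(1) by (intro prod_zero bexI[of _ "2 * m + 1"]) auto
  moreover have "(1 - z) * (\<Sum>k\<le>m. qint z (3 * k + 1) * t_val z a k) = ?L 1 z"
    unfolding sum_distrib_left mult.assoc[symmetric] qint_geometric x_def
    by (intro sum.cong refl, subst t_val_eq_wz_term(2)) (use z z0 a in auto)
  ultimately show ?thesis using z1 by simp
qed

text \<open>\<open>t_ratio\<close> depends on the index only modulo \<open>d\<close>. As
  \<open>r < d\<close>, the induction never steps onto a multiple of \<open>d\<close>, where a
  denominator vanishes.\<close>

lemma t_val_periodic:
  fixes z a :: "'a::field"
  assumes z: "z ^ d = 1" "\<And>j. 0 < j \<Longrightarrow> j < d \<Longrightarrow> z ^ j \<noteq> 1" and "r < d"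
  shows "t_val z a (l * d + r) = t_val z a (l * d) * t_val z a r"
  using assms(3)
proof (induction r)
  case (Suc r)
  have p: "z ^ (l * d + i) = z ^ i" "z ^ (2 * (l * d) + i) = z ^ i" for i
    using z(1) by (simp_all add: power_add power_mult mult.commute[of l] mult.left_commute[of 2])
  have r: "t_ratio z a (l * d + r) = t_ratio z a r"
    using p[of "Suc r"] p[of "2 * r + 1"] p[of "2 * r + 2"]
    unfolding t_ratio_def by (simp add: distrib_left add.assoc del: power_Suc)
  have "z ^ Suc r \<noteq> 1" using z(2)[of "Suc r"] Suc.prems by simp
  moreover from this have "z ^ Suc (l * d + r) \<noteq> 1" using p(1)[of "Suc r"] by (simp only: add_Suc_right not_False_eq_True)
  ultimately show ?case using Suc by (simp add: t_val_Suc r del: power_Suc)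
qed simp

lemma sum_mult_eq_div_mod:
  fixes h :: "nat \<Rightarrow> 'a::comm_monoid_add"
  shows "(\<Sum>k<e * d. h k) = (\<Sum>l<e. \<Sum>r<d. h (l * d + r))"
proof -
  have "(\<Sum>r<d. h (l * d + r)) = sum h {l * d..<l * d + d}" for l
    using sum.shift_bounds_nat_ivl[of h 0 "l * d" d] by (simp add: lessThan_atLeast0 add.commute)
  thus ?thesis by (simp only: sum.nat_group)
qed

text \<open>Since \<open>f\<close> is supported on the lower halves of the blocks of length \<open>d\<close>, adding two indices never
  carries into the next block, and the truncated convolution factors.\<close>

lemma convolution_block_product:
  fixes f g :: "nat \<Rightarrow> 'a::comm_semiring_1"
  assumes n: "n = e * d"
    and f: "\<And>l r. l < e \<Longrightarrow> r < d \<Longrightarrow> f (l * d + r) = g l * f r"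
    and 0: "\<And>r. r < d \<Longrightarrow> d \<le> 2 * r \<Longrightarrow> f r = 0"
  shows "(\<Sum>k<n. \<Sum>j\<le>k. f j * f (k - j)) =
    (\<Sum>l<e. \<Sum>l'<e. if l + l' < e then g l * g l' else 0) * (\<Sum>r<d. f r)\<^sup>2"
proof -
  have "(\<Sum>k<n. \<Sum>j\<le>k. f j * f (k - j)) = (\<Sum>(i, j)\<in>{(i, j). i + j < n}. f i * f j)"
    using sum.nested_swap' sum.triangle_reindex[of "\<lambda>i j. f i * f j" n] by simp
  also have "{(i, j). i + j < n} = {p \<in> {..<n} \<times> {..<n}. fst p + snd p < n}" by auto
  also have "(\<Sum>(i, j)\<in>\<dots>. f i * f j) = (\<Sum>p\<in>{..<n} \<times> {..<n}. if fst p + snd p < n then f (fst p) * f (snd p) else 0)"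
    by (subst sum.inter_filter) (auto simp: case_prod_unfold intro!: sum.cong)
  also have "\<dots> = (\<Sum>i<n. \<Sum>j<n. if i + j < n then f i * f j else 0)"
    by (simp add: sum.cartesian_product case_prod_unfold)
  also have "\<dots> = (\<Sum>l<e. \<Sum>r<d. \<Sum>l'<e. \<Sum>r'<d. if l * d + r + (l' * d + r') < n then f (l * d + r) * f (l' * d + r') else 0)"
    unfolding n sum_mult_eq_div_mod ..
  also have "\<dots> = (\<Sum>l<e. \<Sum>r<d. \<Sum>l'<e. \<Sum>r'<d. (if l + l' < e then g l * g l' else 0) * (f r * f r'))"
  proof (intro sum.cong refl)
    fix l r l' r' assume *: "l \<in> {..<e}" "r \<in> {..<d}" "l' \<in> {..<e}" "r' \<in> {..<d}"
    show "(if l * d + r + (l' * d + r') < n then f (l * d + r) * f (l' * d + r') else 0)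
      = (if l + l' < e then g l * g l' else 0) * (f r * f r')"
    \<comment> \<open>If \<open>r\<close> or \<open>r'\<close> lies in an upper half, both sides are
      0. Otherwise \<open>r + r' < d\<close>, and the condition depends on the block numbers
      only.\<close>
    proof (cases "d \<le> 2 * r \<or> d \<le> 2 * r'")
      case True
      thus ?thesis using * 0[of r] 0[of r'] by (auto simp: f)
    next
      case False
      have "l * d + r + (l' * d + r') < n \<longleftrightarrow> (l + l') * d + (r + r') < e * d"
        by (simp add: n algebra_simps)
      also have "\<dots> \<longleftrightarrow> l + l' < e"
      proof
        assume "l + l' < e"
        hence "(l + l' + 1) * d \<le> e * d" by (intro mult_le_mono1) simp
        thus "(l + l') * d + (r + r') < e * d" using False by simp
      next
        assume "(l + l') * d + (r + r') < e * d"
        hence "(l + l') * d < e * d" by (rule le_less_trans[OF le_add1])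
        thus "l + l' < e" by simp
      qed
      finally have c: "l * d + r + (l' * d + r') < n \<longleftrightarrow> l + l' < e" .
      have "f (l * d + r) = g l * f r" "f (l' * d + r') = g l' * f r'" using * f by auto
      thus ?thesis unfolding c by (simp only:) (simp add: mult_ac)
    qed
  qed
  also have "\<dots> = (\<Sum>l<e. \<Sum>l'<e. (\<Sum>r<d. \<Sum>r'<d. (if l + l' < e then g l * g l' else 0) * (f r * f r')))"
    by (intro sum.cong refl sum.swap)
  also have "\<dots> = (\<Sum>l<e. \<Sum>l'<e. if l + l' < e then g l * g l' else 0) * (\<Sum>r<d. f r)\<^sup>2"
    by (simp only: sum_distrib_left[symmetric] sum_distrib_right[symmetric] sum_product[symmetric] power2_eq_square)
  finally show ?thesis .
qed

section \<open>The truncated convolution at the points needed for the three factors\<close>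

definition c_val :: "'a::field \<Rightarrow> 'a \<Rightarrow> nat \<Rightarrow> 'a" where
  "c_val q a k = qint q (3 * k + 1) * t_val q a k"

definition c_conv :: "'a::field \<Rightarrow> 'a \<Rightarrow> nat \<Rightarrow> 'a" where
  "c_conv q a n = (\<Sum>k<n. \<Sum>j\<le>k. c_val q a j * c_val q a (k - j))"

text \<open>A single block, \<open>e = 1\<close> and \<open>d = n\<close>: the upper half vanishes,
  so the truncation loses nothing and a square remains.\<close>

lemma c_conv_a_eq_power:
  assumes "inj (power q)" "odd n"
  shows "c_conv q (q ^ n) n = (qint q n)\<^sup>2 / q ^ (n - 1)"
proof -
  note q = inj_powerD[OF assms(1)]
  from \<open>odd n\<close> obtain m where n: "n = 2 * m + 1" by (elim oddE)
  have z: "c_val q (q ^ n) r = 0" if "r > m" for r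
    unfolding c_val_def by (subst t_val_eq_0[where m = m]) (use q that n in auto)
  have "c_conv q (q ^ n) n = (\<Sum>l<1::nat. \<Sum>l'<1. if l + l' < 1 then 1 * 1 else 0) * (\<Sum>r<n. c_val q (q ^ n) r)\<^sup>2"
    unfolding c_conv_def by (rule convolution_block_product[where g = "\<lambda>_. 1"]) (use z n in auto)
  also have "(\<Sum>r<n. c_val q (q ^ n) r) = (\<Sum>r\<le>m. c_val q (q ^ n) r)"
    by (rule sum.mono_neutral_right) (use z n in auto)
  also have "\<dots> = qint q n / q ^ m"
    unfolding c_val_def n by (rule sum_t_val_a_eq_power[OF assms(1)])
  finally show ?thesis
    by (simp add: n power_divide flip: power_mult) (simp add: mult.commute)
qed

text \<open>Each pair of factors scales by \<open>1 / a^2\<close>, equally often in numerator and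
  denominator.\<close>

lemma c_val_inverse:
  assumes "a \<noteq> 0"
  shows "c_val q (1 / a) k = c_val q a k"
proof -
  have e: "(1 - 1 / a * x) * (1 / a - x) = (1 - a * x) * (a - x) / a\<^sup>2" for x
    using assms by (simp add: field_simps power2_eq_square)
  have "t_num q (1 / a) k = t_num q a k / (a\<^sup>2) ^ k" "t_den q (1 / a) k = t_den q a k / (a\<^sup>2) ^ k"
    unfolding t_num_def t_den_def e by (simp_all add: prod_dividef)
  thus ?thesis using assms by (simp add: c_val_def t_val_def)
qed

lemma c_conv_root_of_unity:
  fixes z a :: complex
  assumes z: "z ^ n = 1" "z \<noteq> 1" and n: "odd n" and a: "a \<noteq> 0" "norm a < 1"
  shows "c_conv z a n = 0"
proof -
  \<comment> \<open>The order of \<open>z\<close>, possibly a proper divisor of \<open>n\<close>;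
    like \<open>n\<close> it is odd.\<close>
  define d where "d = (LEAST d. d > 0 \<and> z ^ d = 1)"
  have ex: "n > 0 \<and> z ^ n = 1" using z n by (auto intro: odd_pos)
  have d: "d > 0" "z ^ d = 1" using LeastI[of "\<lambda>d. d > 0 \<and> z ^ d = 1", OF ex] by (auto simp: d_def)
  have min: "z ^ j \<noteq> 1" if "0 < j" "j < d" for j
    using not_less_Least[of j "\<lambda>d. d > 0 \<and> z ^ d = 1"] that by (auto simp: d_def)
  have "z ^ n = (z ^ d) ^ (n div d) * z ^ (n mod d)"
    by (simp flip: power_mult power_add)
  hence "z ^ (n mod d) = 1" using d z by simp
  hence "n mod d = 0" using min[of "n mod d"] d by (cases "n mod d = 0") auto
  then obtain e where e: "n = e * d" by (metis mod_0_imp_dvd dvd_def mult.commute)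
  with n have "odd d" by simp
  then obtain m where m: "d = 2 * m + 1" by (elim oddE)
  have "m > 0" using d z(2) m by (cases m) auto
  have z0: "z \<noteq> 0" using d by (auto simp: zero_power)
  have 0: "c_val z a r = 0" if "r < d" "m < r" for r
    unfolding c_val_def by (subst t_val_eq_0[where m = m]) (use that m min z0 a d(2) in auto)
  have periodic: "c_val z a (l * d + r) = t_val z a (l * d) * c_val z a r" if "r < d" for l r
  proof -
    have "z ^ (3 * (l * d + r) + 1) = (z ^ d) ^ (3 * l) * z ^ (3 * r + 1)"
      by (simp add: algebra_simps flip: power_mult power_add)
    hence "z ^ (3 * (l * d + r) + 1) = z ^ (3 * r + 1)" unfolding d(2) by (simp del: power_Suc)
    hence "(1 - z) * qint z (3 * (l * d + r) + 1) = (1 - z) * qint z (3 * r + 1)"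
      unfolding qint_geometric by (simp only:)
    hence "qint z (3 * (l * d + r) + 1) = qint z (3 * r + 1)" using z(2) by simp
    thus ?thesis unfolding c_val_def
      by (subst t_val_periodic[OF d(2) min that]) (simp_all add: mult_ac)
  qed
  have "c_conv z a n = (\<Sum>l<e. \<Sum>l'<e. if l + l' < e then t_val z a (l * d) * t_val z a (l' * d) else 0) * (\<Sum>r<d. c_val z a r)\<^sup>2"
    unfolding c_conv_def
    by (rule convolution_block_product[where g = "\<lambda>l. t_val z a (l * d)", OF e]) (use 0 m periodic in auto)
  also have "(\<Sum>r<d. c_val z a r) = (\<Sum>r\<le>m. c_val z a r)"
    by (rule sum.mono_neutral_right) (use 0 m in auto)
  also have "\<dots> = 0"
    unfolding c_val_def
    by (rule sum_t_val_root_of_unity) (use d min m \<open>m > 0\<close> a in auto)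
  finally show ?thesis by simp
qed

section \<open>Reduction to evaluations at complex points\<close>

definition t_den_factor :: "'a::comm_ring_1 \<Rightarrow> 'a \<Rightarrow> nat \<Rightarrow> 'a" where
  "t_den_factor q a i = q ^ Suc i * (1 + q ^ Suc i)\<^sup>2 * ((1 - a * q ^ Suc i) * (a - q ^ Suc i))"

text \<open>Numerator of \<open>c_val q a k\<close> over the denominator
  \<open>t_den q a (n - 1)\<close> common to all \<open>k < n\<close>.\<close>

definition c_num :: "'a::comm_ring_1 \<Rightarrow> 'a \<Rightarrow> nat \<Rightarrow> nat \<Rightarrow> 'a" where
  "c_num q a n k = qint q (3 * k + 1) * t_num q a k * (\<Prod>i=k..<n-1. t_den_factor q a i)"

text \<open>Numerator of the difference of the two sides, over
  \<open>q ^ (n - 1) * (t_den q a (n - 1))^2\<close>. It uses ring operations only, so evaluations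
  commute with it.\<close>

definition diff_num :: "'a::comm_ring_1 \<Rightarrow> 'a \<Rightarrow> nat \<Rightarrow> 'a" where
  "diff_num q a n = q ^ (n - 1) * (\<Sum>k<n. \<Sum>j\<le>k. c_num q a n j * c_num q a n (k - j))
     - (qint q n)\<^sup>2 * (t_den q a (n - 1))\<^sup>2"

lemma c_val_eq_c_num:
  assumes "t_den q a (n - 1) \<noteq> 0" "k < n"
  shows "c_val q a k = c_num q a n k / t_den q a (n - 1)"
proof -
  have den: "t_den q a j = (\<Prod>i=0..<j. t_den_factor q a i)" for j
    by (simp add: t_den_def t_den_factor_def lessThan_atLeast0)
  have "t_den q a (n - 1) = t_den q a k * (\<Prod>i=k..<n-1. t_den_factor q a i)"
    unfolding den by (rule prod.atLeastLessThan_concat[symmetric]) (use assms(2) in auto)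
  with assms(1) show ?thesis by (auto simp: c_val_def c_num_def t_val_def)
qed

lemma diff_num_eq:
  assumes "t_den q a (n - 1) \<noteq> 0"
  shows "diff_num q a n = (t_den q a (n - 1))\<^sup>2 * (q ^ (n - 1) * c_conv q a n - (qint q n)\<^sup>2)"
proof -
  let ?W = "t_den q a (n - 1)"
  have "c_conv q a n = (\<Sum>k<n. \<Sum>j\<le>k. c_num q a n j * c_num q a n (k - j) / ?W\<^sup>2)"
    unfolding c_conv_def using c_val_eq_c_num[OF assms]
    by (intro sum.cong refl) (simp add: power2_eq_square)
  also have "\<dots> = (\<Sum>k<n. \<Sum>j\<le>k. c_num q a n j * c_num q a n (k - j)) / ?W\<^sup>2"
    by (simp only: sum_divide_distrib)
  finally show ?thesis using assms by (simp add: diff_num_def field_simps)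
qed

section \<open>Compatibility with ring homomorphisms\<close>

context comm_ring_hom
begin

lemma hom_qint: "hom (qint q n) = qint (hom q) n"
  by (simp add: qint_def hom_distribs)

lemma hom_qbinom_add: "hom (qbinom_add q n k) = qbinom_add (hom q) n k"
  by (induction q n k rule: qbinom_add.induct) (simp_all add: hom_distribs)

lemma hom_t_den_factor: "hom (t_den_factor q a i) = t_den_factor (hom q) (hom a) i"
  by (simp add: t_den_factor_def hom_distribs)

lemma hom_t_den: "hom (t_den q a k) = t_den (hom q) (hom a) k"
  by (simp add: t_den_def hom_distribs)

lemma hom_t_num: "hom (t_num q a k) = t_num (hom q) (hom a) k"
  by (simp add: t_num_def hom_qbinom_add hom_distribs)

lemma hom_c_num: "hom (c_num q a n k) = c_num (hom q) (hom a) n k"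
  by (simp add: c_num_def hom_qint hom_t_num hom_t_den_factor hom_distribs)

lemma hom_diff_num: "hom (diff_num q a n) = diff_num (hom q) (hom a) n"
  by (simp add: diff_num_def hom_qint hom_t_den hom_c_num hom_distribs)

end

section \<open>Divisibility and coprimality tested at complex points\<close>

definition eval_q :: "complex \<Rightarrow> rat poly \<Rightarrow> complex" where
  "eval_q z p = poly (map_poly of_rat p) z"

definition eval_qa :: "complex \<Rightarrow> complex \<Rightarrow> qa_poly \<Rightarrow> complex" where
  "eval_qa z a p = poly (map_poly (eval_q z) p) a"

interpretation map_of_rat: map_poly_comm_ring_hom "of_rat :: rat \<Rightarrow> complex" ..

interpretation eval_q: comm_ring_hom "eval_q z" for z
  by unfold_locales (simp_all add: eval_q_def hom_distribs)

interpretation map_eval_q: map_poly_comm_ring_hom "eval_q z" for z ..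

interpretation eval_qa: comm_ring_hom "eval_qa z a" for z a
  by unfold_locales (simp_all add: eval_qa_def hom_distribs)

lemma eval_qa_const [simp]: "eval_qa z a [:p:] = eval_q z p"
  by (simp add: eval_qa_def eval_q.map_poly_pCons_hom)

lemma eval_q_X [simp]: "eval_q z (pCons 0 1) = z"
  by (simp add: eval_q_def)

lemma eval_qa_q_poly [simp]: "eval_qa z a q_poly = z"
  by (simp add: q_poly_def)

lemma eval_qa_a_poly [simp]: "eval_qa z a a_poly = a"
  by (simp add: a_poly_def eval_qa_def eval_q.map_poly_pCons_hom)

lemma eval_q_eq_0I:
  assumes "infinite S" "\<And>z. z \<in> S \<Longrightarrow> eval_q z p = 0"
  shows "p = 0"
proof -
  have "infinite {z. poly (map_poly of_rat p :: complex poly) z = 0}"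
    using assms by (elim infinite_super[rotated]) (auto simp: eval_q_def)
  hence "map_poly of_rat p = (0 :: complex poly)" using poly_roots_finite by blast
  thus ?thesis by simp
qed

text \<open>A divisor of degree 0 divides both coefficients and is thus a unit, so the polynomial is
  irreducible; unique factorization makes it prime.\<close>

lemma prime_elem_linear:
  fixes b c :: "rat poly"
  assumes "coprime b c" "c \<noteq> 0"
  shows "prime_elem [:b, c:]"
proof (rule irreducible_imp_prime_elem, rule irreducibleI)
  have unit: "is_unit p" if dv: "p dvd [:b, c:]" and deg: "degree p = 0" for p
  proof -
    obtain d where d: "p = [:d:]" using deg by (elim degree_eq_zeroE)
    hence "d dvd coeff [:b, c:] i" for i using dv by (simp add: const_poly_dvd_iff)
    from this[of 0] this[of 1] have "d dvd b" "d dvd c" by simp_all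
    hence "is_unit d" using assms(1) coprime_common_divisor by blast
    thus ?thesis by (simp add: d is_unit_const_poly_iff)
  qed
  show "[:b, c:] \<noteq> 0" using assms by simp
  show "\<not> is_unit [:b, c:]" using assms by (auto simp: is_unit_poly_iff)
  fix x y assume xy: "[:b, c:] = x * y"
  hence "x \<noteq> 0" "y \<noteq> 0" using assms by auto
  hence "degree x + degree y = 1" using assms xy by (metis degree_mult_eq degree_pCons_eq degree_pCons_0 pCons_eq_0_iff One_nat_def)
  hence "degree x = 0 \<or> degree y = 0" by auto
  thus "is_unit x \<or> is_unit y" using unit[of x] unit[of y] xy by auto
qed

text \<open>Pseudo-division leaves a remainder free of \<open>a\<close>, which vanishes at
  infinitely many \<open>q\<close> and is thus 0. Primality then removes the multiplier
  \<open>u\<close>.\<close>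

lemma linear_dvdI:
  fixes b c :: "rat poly"
  assumes "coprime b c" "c \<noteq> 0" "infinite S"
    and zero: "\<And>z. z \<in> S \<Longrightarrow> \<exists>a. eval_qa z a [:b, c:] = 0 \<and> eval_qa z a f = 0"
  shows "[:b, c:] dvd f"
proof -
  let ?p = "[:b, c:]"
  define r where "r = pseudo_mod f ?p"
  have p0: "?p \<noteq> 0" using assms by simp
  from pseudo_mod(1)[OF p0, of f] obtain u Q where u: "u \<noteq> 0" "Polynomial.smult u f = ?p * Q + r"
    unfolding r_def by blast
  have "degree r = 0" using pseudo_mod(2)[OF p0, of f] assms(2) by (auto simp: r_def)
  then obtain r0 where r0: "r = [:r0:]" by (elim degree_eq_zeroE)
  have "eval_q z r0 = 0" if z: "z \<in> S" for z
  proof -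
    obtain a where a: "eval_qa z a ?p = 0" "eval_qa z a f = 0" using zero[OF z] by blast
    have "eval_qa z a ([:u:] * f) = eval_qa z a (?p * Q + r)" using u(2) by simp
    thus ?thesis using a by (simp only: eval_qa.hom_mult eval_qa.hom_add r0 eval_qa_const) simp
  qed
  hence "r0 = 0" by (rule eval_q_eq_0I[OF assms(3)])
  hence "[:u:] * f = ?p * Q" using u(2) r0 by simp
  hence "?p dvd [:u:] * f" by (simp only: dvd_triv_left)
  moreover have "\<not> ?p dvd [:u:]" using u(1) assms(2) dvd_imp_degree_le[of ?p "[:u:]"] by auto
  ultimately show ?thesis using prime_elem_dvd_multD[OF prime_elem_linear[OF assms(1,2)]] by blast
qed

text \<open>The linear polynomial is prime, and one zero of it outside the zeros of \<open>f\<close>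
  shows that it does not divide \<open>f\<close>.\<close>

lemma coprime_linearI:
  fixes b c :: "rat poly"
  assumes "coprime b c" "c \<noteq> 0" "eval_qa z a [:b, c:] = 0" "eval_qa z a f \<noteq> 0"
  shows "coprime [:b, c:] f"
proof (rule prime_elem_imp_coprime[OF prime_elem_linear[OF assms(1,2)]])
  show "\<not> [:b, c:] dvd f" using assms(3,4) by (auto simp: dvd_def eval_qa.hom_mult simp del: mult_pCons_left)
qed

text \<open>The remainder has degree below \<open>n - 1\<close> but vanishes at the
  \<open>n - 1\<close> nontrivial roots of unity.\<close>

lemma qint_poly_dvdI:
  assumes "n > 0" and zero: "\<And>z. z ^ n = 1 \<Longrightarrow> z \<noteq> 1 \<Longrightarrow> eval_q z p = 0"
  shows "qint [:0, 1:] n dvd p"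
proof (rule ccontr)
  let ?Q = "qint [:0, 1:] n :: rat poly"
  assume "\<not> ?Q dvd p"
  hence r: "p mod ?Q \<noteq> 0" by (simp add: dvd_eq_mod_eq_0)
  have Q0: "?Q \<noteq> 0"
  proof
    assume "?Q = 0"
    hence "poly ?Q 1 = 0" by simp
    thus False using assms(1) by (simp add: qint_def poly_sum)
  qed
  have "degree ?Q \<le> n - 1"
    unfolding qint_def by (rule degree_sum_le) (auto simp: degree_power_eq)
  moreover have "degree (p mod ?Q) < degree ?Q" using degree_mod_less[OF Q0] r by blast
  ultimately have less: "degree (p mod ?Q) < n - 1" by simp
  let ?r = "map_poly of_rat (p mod ?Q) :: complex poly"
  have r0: "?r \<noteq> 0" using r by simp
  have root: "poly ?r z = 0" if "z ^ n = 1" "z \<noteq> 1" for z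
  proof -
    have "(1 - z) * qint z n = 0" using that by (simp add: qint_geometric)
    hence "eval_q z ?Q = 0" using that by (simp add: eval_q.hom_qint)
    moreover have "p = ?Q * (p div ?Q) + p mod ?Q" by simp
    hence "eval_q z p = eval_q z ?Q * eval_q z (p div ?Q) + eval_q z (p mod ?Q)"
      by (metis eval_q.hom_mult eval_q.hom_add)
    ultimately show ?thesis using zero[OF that] unfolding eval_q_def[symmetric] by simp
  qed
  have "n - 1 = card ({z::complex. z ^ n = 1} - {1})"
    using card_roots_unity_eq[OF assms(1)] by (subst card_Diff_singleton) auto
  also have "\<dots> \<le> card {z. poly ?r z = 0}"
    by (rule card_mono[OF poly_roots_finite[OF r0]]) (use root in auto)
  also have "\<dots> \<le> degree ?r" by (rule poly_roots_degree[OF r0])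
  finally show False using less by simp
qed

text \<open>For fixed \<open>z\<close>, a polynomial in \<open>a\<close> with infinitely many zeros
  is 0, so every coefficient of \<open>f\<close> vanishes at \<open>z\<close>.\<close>

lemma qint_const_dvdI:
  assumes "n > 0" "infinite S"
    and zero: "\<And>z a. z ^ n = 1 \<Longrightarrow> z \<noteq> 1 \<Longrightarrow> a \<in> S \<Longrightarrow> eval_qa z a f = 0"
  shows "[:qint [:0, 1:] n:] dvd f"
  unfolding const_poly_dvd_iff
proof (intro allI qint_poly_dvdI assms(1))
  fix i and z :: complex assume z: "z ^ n = 1" "z \<noteq> 1"
  have "infinite {a. poly (map_poly (eval_q z) f) a = 0}"
    using assms(2) zero[OF z] by (elim infinite_super[rotated]) (auto simp: eval_qa_def)
  hence "map_poly (eval_q z) f = 0" using poly_roots_finite by blast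
  hence "coeff (map_poly (eval_q z) f) i = 0" by simp
  thus "eval_q z (coeff f i) = 0" by simp
qed

text \<open>A common divisor is free of \<open>a\<close>. If it is not a unit, it has a complex root
  \<open>z\<close>, necessarily a nontrivial \<open>n\<close>-th root of unity, and \<open>f\<close>
  vanishes there for every \<open>a\<close>.\<close>

lemma coprime_qint_constI:
  assumes "n > 0" and nz: "\<And>z. z ^ n = 1 \<Longrightarrow> z \<noteq> 1 \<Longrightarrow> \<exists>a. eval_qa z a f \<noteq> 0"
  shows "coprime [:qint [:0, 1:] n:] f"
proof (rule coprimeI)
  fix g assume g: "g dvd [:qint [:0, 1:] n:]" "g dvd f"
  let ?Q = "qint [:0, 1:] n :: rat poly"
  have "poly ?Q 1 \<noteq> 0" using assms(1) by (simp add: qint_def poly_sum)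
  hence Q0: "?Q \<noteq> 0" by auto
  have "degree g = 0" using dvd_imp_degree_le[OF g(1)] Q0 by simp
  then obtain d where d: "g = [:d:]" by (elim degree_eq_zeroE)
  with g have dQ: "d dvd ?Q" by simp
  show "is_unit g"
  proof (rule ccontr)
    assume "\<not> is_unit g"
    hence "degree d \<noteq> 0" using dQ Q0 by (auto simp: d is_unit_const_poly_iff is_unit_iff_degree)
    hence "degree (map_poly of_rat d :: complex poly) \<noteq> 0" by simp
    hence "\<not> constant (poly (map_poly of_rat d :: complex poly))" by (simp add: constant_degree)
    then obtain z where z: "eval_q z d = 0" using fundamental_theorem_of_algebra unfolding eval_q_def by blast
    from dQ z have "eval_q z ?Q = 0" by (auto simp: dvd_def eval_q.hom_mult)
    hence Qz: "qint z n = 0" by (simp add: eval_q.hom_qint)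
    hence "z ^ n = 1" using qint_geometric[of z n] by simp
    moreover have "z \<noteq> 1" using Qz assms(1) by (auto simp: qint_def)
    ultimately obtain a where "eval_qa z a f \<noteq> 0" using nz by blast
    moreover from g(2) obtain h where "f = g * h" by (elim dvdE)
    ultimately show False using z by (simp add: eval_qa.hom_mult d del: mult_pCons_left)
  qed
qed


section \<open>Identification with \<open>c_q\<close> and zeros of the denominator\<close>

lemma qpochs_quotient_eq_t_val:
  fixes q a :: "'a::field"
  assumes q: "inj (power q)" and a: "a \<noteq> 0"
  shows "qpochs [a * q, q / a, q] (q\<^sup>2) k * q powi (- int ((k + 1) choose 2)) /
    (qpochs [a * q, q / a] q k * qpoch (q\<^sup>2) (q\<^sup>2) k) = t_val q a k"
proof (induction k)
  case 0
  show ?case by (simp add: qpochs_def qpoch_def numeral_2_eq_2)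
next
  case (Suc k)
  note q = inj_powerD[OF q]
  define X where "X = q ^ k"
  have S: "qpoch x y (Suc k) = qpoch x y k * (1 - x * y ^ k)" for x y :: 'a
    by (simp add: qpoch_def)
  \<comment> \<open>The binomial exponent grows by \<open>k + 1\<close> from \<open>k\<close> to
    \<open>k + 1\<close>.\<close>
  have pw: "q powi (- int ((Suc k + 1) choose 2)) = q powi (- int ((k + 1) choose 2)) * (1 / q ^ Suc k)"
    by (simp add: numeral_2_eq_2 power_int_minus power_add field_simps flip: of_nat_add of_nat_Suc)
  have X: "q ^ (2 * k + 1) = q * X\<^sup>2" "q ^ (2 * k + 2) = q\<^sup>2 * X\<^sup>2" "q ^ Suc k = q * X" "(q\<^sup>2) ^ k = X\<^sup>2" "q ^ k = X"
    by (simp_all add: X_def power_even_eq power2_eq_square power_mult_distrib)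
  have e: "1 - q / a * y = (a - q * y) / a" for y using a by (simp add: field_simps)
  have r: "(1 - a * q * X\<^sup>2) * ((a - q * X\<^sup>2) / a) * (1 - q * X\<^sup>2) * (1 / (q * X)) /
      ((1 - a * q * X) * ((a - q * X) / a) * (1 - q\<^sup>2 * X\<^sup>2)) = t_ratio q a k"
    unfolding t_ratio_def X using a by (simp add: divide_simps mult_ac)
  have "q ^ Suc k \<noteq> 1" using q(3) by blast
  thus ?case
    unfolding t_val_Suc[OF \<open>q ^ Suc k \<noteq> 1\<close>] Suc[symmetric] r[symmetric] pw
    unfolding qpochs_def list.map prod_list.Cons prod_list.Nil S X e
    by (simp add: mult_ac)
qed

lemma inj_power_norm:
  fixes q :: complex
  assumes "0 < norm q" "norm q < 1"
  shows "inj (power q)"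
proof (rule injI)
  fix i j assume "q ^ i = q ^ j"
  hence "norm q ^ i = norm q ^ j" by (metis norm_power)
  thus "i = j"
    using power_strict_decreasing[of i j "norm q"] power_strict_decreasing[of j i "norm q"] assms
    by (cases i j rule: linorder_cases) auto
qed

lemma t_den_eq_0_iff:
  "t_den q a k = 0 \<longleftrightarrow> (\<exists>j\<in>{1..k}. q = 0 \<or> q ^ j = -1 \<or> a * q ^ j = 1 \<or> a = q ^ j)"
  for q a :: "'a::field"
proof -
  have "t_den q a k = 0 \<longleftrightarrow> (\<exists>i<k. q = 0 \<or> q ^ Suc i = -1 \<or> a * q ^ Suc i = 1 \<or> a = q ^ Suc i)"
    by (auto simp: t_den_def eq_neg_iff_add_eq_0 add.commute simp del: power_Suc)
  also have "\<dots> \<longleftrightarrow> (\<exists>j\<in>Suc ` {..<k}. q = 0 \<or> q ^ j = -1 \<or> a * q ^ j = 1 \<or> a = q ^ j)"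
    by blast
  also have "Suc ` {..<k} = {1..k}" by (auto simp: image_Suc_lessThan)
  finally show ?thesis .
qed

text \<open>A zero would force \<open>q ^ (n + j) = 1\<close>, or \<open>q ^ n = q ^ j\<close> with
  \<open>0 < j < n\<close>, or \<open>q ^ (2 * j) = 1\<close>.\<close>

lemma t_den_nz_power:
  fixes q :: "'a::field"
  assumes "inj (power q)"
  shows "t_den q (q ^ n) (n - 1) \<noteq> 0" "t_den q (1 / q ^ n) (n - 1) \<noteq> 0"
proof -
  note q = inj_powerD[OF assms]
  have m1: "q ^ j \<noteq> -1" if "j > 0" for j
  proof
    assume "q ^ j = -1"
    hence "q ^ (j * 2) = 1" unfolding power_mult by simp
    thus False using q(3)[of "j * 2"] that by simp
  qed
  show "t_den q (q ^ n) (n - 1) \<noteq> 0"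
    unfolding t_den_eq_0_iff power_add[symmetric] using q m1 by auto
  show "t_den q (1 / q ^ n) (n - 1) \<noteq> 0"
  proof -
    have "1 / q ^ n * q ^ j \<noteq> 1" "1 / q ^ n \<noteq> q ^ j" if "j \<in> {1..n-1}" for j
      using q(1,2) q(3)[of "n + j"] q(3)[of "j + n"] that by (auto simp: divide_simps power_add)
    thus ?thesis unfolding t_den_eq_0_iff using q(1) m1 by auto
  qed
qed

text \<open>Oddness of \<open>n\<close> excludes \<open>z ^ j = -1\<close>, whose
  \<open>n\<close>-th power would read \<open>1 = -1\<close>; the other factors are nonzero because
  \<open>norm z = 1\<close> and \<open>norm a < 1\<close>.\<close>

lemma t_den_nz_root_of_unity:
  fixes z a :: complex
  assumes z: "z ^ n = 1" and n: "odd n" and a: "a \<noteq> 0" "norm a < 1"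
  shows "t_den z a k \<noteq> 0"
proof -
  have nz: "norm z = 1" using power_eq_1_iff[OF z] n by auto
  have "z ^ j \<noteq> -1" for j
  proof
    assume "z ^ j = -1"
    hence "(z ^ n) ^ j = (-1) ^ n" by (metis power_mult mult.commute)
    thus False using z n by simp
  qed
  moreover have "a * z ^ j \<noteq> 1" "a \<noteq> z ^ j" for j
  proof -
    have "norm (a * z ^ j) < 1" "norm (z ^ j) = 1" using nz a by (simp_all add: norm_mult norm_power)
    thus "a * z ^ j \<noteq> 1" "a \<noteq> z ^ j" using a by auto
  qed
  moreover have "z \<noteq> 0" using nz by auto
  ultimately show ?thesis unfolding t_den_eq_0_iff by blast
qed

lemma infinite_punctured_disc: "infinite {z::complex. 0 < norm z \<and> norm z < 1}"
proof (rule infinite_super)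
  show "range (\<lambda>i::nat. 1 / of_nat (i + 2) :: complex) \<subseteq> {z. 0 < norm z \<and> norm z < 1}"
    by (auto simp: norm_divide simp flip: of_nat_Suc of_nat_add)
  show "infinite (range (\<lambda>i::nat. 1 / of_nat (i + 2) :: complex))"
    by (rule range_inj_infinite) (auto simp: inj_def simp flip: of_nat_add of_nat_Suc)
qed

theorem theorem2p3:
  fixes n :: nat
  assumes "n > 0" and "odd n"
  shows "ratfun_cong
           (\<Sum>k = 0..n - 1. \<Sum>j = 0..k. c_q j * c_q (k - j))
           (q_rat powi (1 - int n) * (qint q_rat n)\<^sup>2)
           (qint q_poly n * (1 - a_poly * q_poly ^ n) * (a_poly - q_poly ^ n))"
proof -
  let ?D = "{z::complex. 0 < norm z \<and> norm z < 1}"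
  let ?x = "[:0, 1:] :: rat poly"
  \<comment> \<open>As polynomials in \<open>a\<close>, \<open>[n]\<close> is constant and the other
    two factors are linear with coprime coefficients, the form that the divisibility criteria
    expect.\<close>
  let ?C = "[:qint ?x n:]" and ?A = "[:1, - (?x ^ n):]" and ?B = "[:- (?x ^ n), 1:]"
  let ?N = "diff_num q_poly a_poly n" and ?W = "t_den q_poly a_poly (n - 1)"
  let ?V = "q_poly ^ (n - 1) * ?W\<^sup>2"
  have C: "qint q_poly n = ?C"
    by (simp add: q_poly_def qint_def poly_const_pow coeff_lift_hom.hom_sum)
  have A: "1 - a_poly * q_poly ^ n = ?A" and B: "a_poly - q_poly ^ n = ?B"
    by (auto simp: q_poly_def a_poly_def poly_const_pow coeff_pCons coeff_1 intro!: poly_eqI split: nat.split)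
  have x0: "- (?x ^ n) \<noteq> 0" by simp
  have copA: "coprime 1 (- (?x ^ n))" and copB: "coprime (- (?x ^ n)) 1" by simp_all
  have evN: "eval_qa z a ?N = diff_num z a n" and evW: "eval_qa z a ?W = t_den z a (n - 1)"
    and evV: "eval_qa z a ?V = z ^ (n - 1) * (t_den z a (n - 1))\<^sup>2"
    and evA: "eval_qa z a ?A = 1 - a * z ^ n" and evB: "eval_qa z a ?B = a - z ^ n"
    and evC: "eval_qa z a ?C = qint z n" for z a
    unfolding A[symmetric] B[symmetric] C[symmetric]
    by (simp_all add: eval_qa.hom_diff_num eval_qa.hom_t_den eval_qa.hom_qint eval_qa.hom_mult
        eval_qa.hom_power eval_qa.hom_minus)

  have dvdB: "?B dvd ?N"
  proof (rule linear_dvdI[OF copB _ infinite_punctured_disc])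
    fix z :: complex assume "z \<in> ?D"
    hence inj: "inj (power z)" by (auto intro: inj_power_norm)
    have "eval_qa z (z ^ n) ?N = 0"
      unfolding evN diff_num_eq[OF t_den_nz_power(1)[OF inj]] c_conv_a_eq_power[OF inj assms(2)]
      using inj_powerD(1)[OF inj] by simp
    thus "\<exists>a. eval_qa z a ?B = 0 \<and> eval_qa z a ?N = 0" unfolding evB by (intro exI[of _ "z ^ n"]) simp
  qed simp
  have dvdA: "?A dvd ?N"
  proof (rule linear_dvdI[OF copA x0 infinite_punctured_disc])
    fix z :: complex assume "z \<in> ?D"
    hence inj: "inj (power z)" by (auto intro: inj_power_norm)
    note z0 = inj_powerD(1)[OF inj]
    have "c_conv z (1 / z ^ n) n = c_conv z (z ^ n) n"
      unfolding c_conv_def using z0 by (simp add: c_val_inverse)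
    hence "eval_qa z (1 / z ^ n) ?N = 0"
      unfolding evN diff_num_eq[OF t_den_nz_power(2)[OF inj]] using c_conv_a_eq_power[OF inj assms(2)] z0 by simp
    thus "\<exists>a. eval_qa z a ?A = 0 \<and> eval_qa z a ?N = 0" using z0 unfolding evA by (intro exI[of _ "1 / z ^ n"]) simp
  qed
  have dvdC: "?C dvd ?N"
  proof (rule qint_const_dvdI[OF assms(1) infinite_punctured_disc])
    fix z a :: complex assume z: "z ^ n = 1" "z \<noteq> 1" and a: "a \<in> ?D"
    have "(1 - z) * qint z n = 0" using z by (simp add: qint_geometric)
    hence "qint z n = 0" using z by simp
    moreover have "c_conv z a n = 0" by (rule c_conv_root_of_unity) (use z a assms in auto)
    moreover have "t_den z a (n - 1) \<noteq> 0" by (rule t_den_nz_root_of_unity[OF z(1)]) (use a assms in auto)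
    ultimately show "eval_qa z a ?N = 0" unfolding evN by (simp add: diff_num_eq)
  qed

  \<comment> \<open>A sample value of \<open>q\<close>, neither 0 nor a root of unity. Paired with
    the zero in \<open>a\<close> of \<open>?A\<close> or \<open>?B\<close>, it shows that the other
    polynomial does not vanish there.\<close>
  let ?h = "1 / 2 :: complex"
  have inj: "inj (power ?h)" by (rule inj_power_norm) (auto simp: norm_divide)
  note h = inj_powerD[OF inj]
  have hC: "qint ?h n \<noteq> 0" using qint_geometric[of ?h n] h(3)[of n] assms by auto
  have "1 - ?h ^ n * ?h ^ n \<noteq> 0" using h(3)[of "n + n"] assms(1) by (simp add: power_add)
  hence AB: "coprime ?A ?B"
    by (intro coprime_linearI[OF copA x0, of ?h "1 / ?h ^ n"]) (use h(1) in \<open>auto simp only: evA evB\<close>, auto simp: field_simps)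
  have AC: "coprime ?A ?C"
    by (intro coprime_linearI[OF copA x0, of ?h "1 / ?h ^ n"]) (use h(1) hC in \<open>auto simp only: evA evC\<close>, auto)
  have BC: "coprime ?B ?C"
    by (intro coprime_linearI[OF copB _, of ?h "?h ^ n"]) (use h(1) hC in \<open>auto simp only: evB evC\<close>, auto)
  have AV: "coprime ?A ?V"
    by (intro coprime_linearI[OF copA x0, of ?h "1 / ?h ^ n"])
       (use h(1) t_den_nz_power(2)[OF inj, of n] in \<open>auto simp only: evA evV\<close>, auto)
  have BV: "coprime ?B ?V"
    by (intro coprime_linearI[OF copB _, of ?h "?h ^ n"])
       (use h(1) t_den_nz_power(1)[OF inj, of n] in \<open>auto simp only: evB evV\<close>, auto)
  have CV: "coprime ?C ?V"
  proof (rule coprime_qint_constI[OF assms(1)])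
    fix z :: complex assume z: "z ^ n = 1" "z \<noteq> 1"
    \<comment> \<open>Here \<open>1 / 2\<close> serves as a value of \<open>a\<close>, of norm below
      1.\<close>
    have "t_den z ?h (n - 1) \<noteq> 0" by (rule t_den_nz_root_of_unity[OF z(1) assms(2)]) (auto simp: norm_divide)
    moreover have "z \<noteq> 0" using z assms(1) by (auto simp: zero_power)
    ultimately show "\<exists>a. eval_qa z a ?V \<noteq> 0" unfolding evV by (intro exI[of _ ?h]) auto
  qed

  have "?C * ?A dvd ?N" using AC dvdA dvdC by (intro divides_mult) (auto simp: coprime_commute)
  moreover have "coprime (?C * ?A) ?B"
    using AB BC by (simp only: coprime_mult_left_iff coprime_commute[of ?C])
  ultimately have "?C * ?A * ?B dvd ?N" using dvdB by (intro divides_mult[of "?C * ?A"])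
  then obtain U where U: "?N = ?C * ?A * ?B * U" by (elim dvdE)
  have VP: "coprime ?V (?C * ?A * ?B)"
    using AV BV CV by (simp only: coprime_mult_right_iff coprime_commute[of ?V])

  have "eval_qa ?h (?h ^ n) ?W \<noteq> 0" using t_den_nz_power(1)[OF inj] by (simp only: evW not_False_eq_True)
  hence W0: "?W \<noteq> 0" by auto
  have q0: "q_poly \<noteq> 0" and a0: "a_poly \<noteq> 0" by (simp_all add: q_poly_def a_poly_def)
  have rat: "q_rat = to_fract q_poly" "a_rat = to_fract a_poly" by (simp_all add: q_rat_def a_rat_def)
  have W: "t_den q_rat a_rat (n - 1) = to_fract ?W" and N: "diff_num q_rat a_rat n = to_fract ?N"
    by (simp_all add: rat to_fract_hom.hom_t_den to_fract_hom.hom_diff_num)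
  \<comment> \<open>A coincidence of powers of the indeterminate would survive evaluation at
    \<open>q = 1 / 2\<close>.\<close>
  have injq: "inj (power q_rat)"
  proof (rule injI)
    fix i j assume "q_rat ^ i = q_rat ^ j"
    hence "q_poly ^ i = q_poly ^ j" by (simp add: rat flip: to_fract_hom.hom_power)
    hence "eval_qa ?h 0 (q_poly ^ i) = eval_qa ?h 0 (q_poly ^ j)" by simp
    thus "i = j" unfolding eval_qa.hom_power eval_qa_q_poly h(2) .
  qed
  have c: "c_q k = c_val q_rat a_rat k" for k
    using qpochs_quotient_eq_t_val[OF injq, of a_rat k] a0
    by (simp add: c_q_def Let_def c_val_def rat mult.assoc flip: times_divide_eq_right)
  have "(\<Sum>k = 0..n - 1. \<Sum>j = 0..k. c_q j * c_q (k - j)) = c_conv q_rat a_rat n"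
    unfolding c_conv_def c using assms(1) by (intro sum.cong) (auto simp: atMost_atLeast0)
  moreover have "q_rat powi (1 - int n) = 1 / q_rat ^ (n - 1)"
  proof -
    have "1 - int n = - int (n - 1)" using assms(1) by simp
    thus ?thesis by (simp only: power_int_minus power_int_of_nat inverse_eq_divide)
  qed
  ultimately have "(\<Sum>k = 0..n - 1. \<Sum>j = 0..k. c_q j * c_q (k - j)) - q_rat powi (1 - int n) * (qint q_rat n)\<^sup>2
    = c_conv q_rat a_rat n - (qint q_rat n)\<^sup>2 / q_rat ^ (n - 1)" by simp
  also have "\<dots> = diff_num q_rat a_rat n / (q_rat ^ (n - 1) * (t_den q_rat a_rat (n - 1))\<^sup>2)"
  proof -
    have "t_den q_rat a_rat (n - 1) \<noteq> 0" unfolding W using W0 by simp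
    moreover have "q_rat ^ (n - 1) \<noteq> 0" using q0 by (simp add: rat)
    moreover have "c - e / p = w\<^sup>2 * (p * c - e) / (p * w\<^sup>2)" if "w \<noteq> 0" "p \<noteq> 0" for c e p w :: qa_ratfun
      using that by (simp add: field_simps)
    ultimately show ?thesis by (simp only: diff_num_eq not_False_eq_True)
  qed
  also have "\<dots> = to_fract (?C * ?A * ?B) * (to_fract U / to_fract ?V)"
    unfolding N W U by (simp only: rat to_fract_hom.hom_mult to_fract_hom.hom_power times_divide_eq_right)
  finally show ?thesis
    unfolding ratfun_cong_def C A B using VP W0 q0 by (intro exI[of _ U] exI[of _ ?V]) simp
qed

end
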